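(* Suppose $\alpha\in[1,2)$ and $\beta\in[1,\alpha]$. Then $$E_{\alpha,\beta}(\Re z)\le |E_{\alpha,\beta}(z)|\le E_{\alpha,\beta}\big((\Re (z^{1/\alpha}))^{\alpha}\big)$$ for all $z\in\mathbb{C}$ with $\Re z\ge 0$. Moreover, if $\alpha=2$ and $\beta\in[1,3]$, these two inequalities hold for all $z\in\mathbb{C}\setminus(-\infty,0]$.
   Context: For $\alpha>0$ and $\beta\in\mathbb{R}$, the two-parameter Mittag-Leffler function is the entire function $E_{\alpha,\beta}(z)=\sum_{k=0}^{\infty}\frac{z^k}{\Gamma(\alpha k+\beta)}$, $z\in\mathbb{C}$. $\Re z$ denotes the real part of $z$, and $z^{1/\alpha}$ denotes the principal branch on $\mathbb{C}\setminus(-\infty,0]$ (with value $0$ at $z=0$). *)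

theory Defs
  imports "HOL-Analysis.Analysis"
begin

text \<open>
  The type is left generic so that the same series serves complex and real arguments.
  \<^const>\<open>rGamma\<close> is the entire function \<open>1 / \<Gamma>\<close>, with value \<open>0\<close> at the poles of \<open>\<Gamma>\<close>.
  For \<open>\<alpha> > 0\<close> the series converges everywhere; other values of \<open>\<alpha>\<close> are not meaningful.
\<close>
definition mittag_leffler :: "real \<Rightarrow> real \<Rightarrow> 'a \<Rightarrow> 'a::{real_normed_field,banach}"
  where "mittag_leffler \<alpha> \<beta> z = (\<Sum>k. of_real (rGamma (\<alpha> * real k + \<beta>)) * z ^ k)"

end

theory Submission
  imports Defs "HOL-Complex_Analysis.Complex_Analysis" "HOL-Real_Asymp.Real_Asymp"
    "HOL-Computational_Algebra.Fundamental_Theorem_Algebra" "HOL-Probability.Giry_Monad"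
begin

text \<open>
  Let \<open>rising a n\<close> be the coefficient of \<open>s ^ n\<close> in \<open>(1 - s) powr (- a)\<close>. Since
  \<open>n powr (1 - a) * rising a n\<close> tends to \<open>1 / \<Gamma>(a)\<close>, the function \<open>E\<^bsub>\<alpha>,\<beta>\<^esub>\<close> is a limit of
  discrete solutions of fractional difference equations, and it suffices to prove the two
  inequalities for these.

  Lower bound, forward difference scheme: the polynomials with generating function
  \<open>(1 - s) powr (\<alpha> - \<beta>) / ((1 - s) powr \<alpha> - l * s)\<close>. For \<open>1 \<le> \<alpha> < 2\<close> and \<open>1 \<le> \<beta> \<le> \<alpha>\<close> all
  coefficients of their recurrence except the leading one have a favourable sign, so the quotient
  of the absolute values at \<open>l\<close> and at \<open>Re l\<close> cannot decrease along the recurrence. For \<open>\<alpha> = 2\<close> and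
  \<open>1 \<le> \<beta> \<le> 3\<close> the polynomials have only real roots (Enestroem-Kakeya and a
  Hermite-Biehler argument), which gives \<open>\<bar>p(z)\<bar> \<ge> \<bar>p(Re z)\<bar>\<close> factor by factor.

  Upper bound, backward difference scheme: the power series with generating function
  \<open>(1 - s) powr (\<alpha> - \<beta>) / ((1 - s) powr \<alpha> - \<mu> powr \<alpha>)\<close>. The factor \<open>(1 - s) powr (1 - \<beta>)\<close> has
  nonnegative coefficients, so \<open>\<beta> = 1\<close> suffices. There a contour integral shows that
  \<open>1 / (1 - \<mu> powr \<alpha>)\<close> is a positive mixture of the functions \<open>1 / (1 - \<mu> * t)\<close>, \<open>t \<le> 1\<close>; replacing \<open>\<mu>\<close>
  by \<open>Re \<mu>\<close> can only increase the absolute value of each of them.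
\<close>

section \<open>Scaled binomial coefficients\<close>

definition rising :: "real \<Rightarrow> nat \<Rightarrow> real"
  where "rising a n = pochhammer a n / fact n"

lemma rising_0 [simp]: "rising a 0 = 1"
  by (simp add: rising_def)

lemma rising_1 [simp]: "rising a (Suc 0) = a"
  by (simp add: rising_def)

lemma rising_Suc: "rising a (Suc n) = rising a n * (a + real n) / real (Suc n)"
  by (simp add: rising_def pochhammer_Suc field_simps)

lemma rising_nonneg: "0 \<le> a \<Longrightarrow> 0 \<le> rising a n"
  by (induction n) (auto simp: rising_Suc)

lemma rising_pos: "0 < a \<Longrightarrow> 0 < rising a n"
  by (induction n) (auto simp: rising_Suc simp del: of_nat_Suc)

lemma rising_nonpos: "- 1 \<le> a \<Longrightarrow> a \<le> 0 \<Longrightarrow> rising a (Suc n) \<le> 0"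
  by (induction n) (auto simp: rising_Suc[of _ "Suc _"] divide_nonpos_pos mult_nonpos_nonneg simp del: of_nat_Suc)

text \<open>The factors \<open>a\<close> and \<open>a + 1\<close> are nonpositive and all later ones
  nonnegative. With \<open>a = - \<alpha>\<close> this fixes the signs in the forward
  recurrence.\<close>

lemma rising_nonneg_Suc_Suc:
  assumes "- 2 \<le> a" "a \<le> - 1"
  shows "0 \<le> rising a (Suc (Suc n))"
proof (induction n)
  case 0
  have "0 \<le> a * (a + 1)" using assms by (intro mult_nonpos_nonpos) auto
  then show ?case by (simp add: rising_Suc)
next
  case (Suc n)
  then show ?case using assms by (subst rising_Suc) (auto intro!: mult_nonneg_nonneg divide_nonneg_nonneg)
qed

text \<open>The Chu-Vandermonde identity: the product of \<open>(1 - s) powr (- a)\<close> and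
  \<open>(1 - s) powr (- b)\<close>, read off coefficientwise.\<close>

lemma rising_add: "rising (a + b) n = (\<Sum>j\<le>n. rising a j * rising b (n - j))"
proof -
  have "rising (a + b) n = (\<Sum>j\<le>n. of_nat (n choose j) * pochhammer a j * pochhammer b (n - j) / fact n)"
    by (simp add: rising_def pochhammer_binomial_sum sum_divide_distrib)
  also have "\<dots> = (\<Sum>j\<le>n. rising a j * rising b (n - j))"
    by (intro sum.cong) (auto simp: rising_def binomial_fact)
  finally show ?thesis .
qed

lemma rising_sums:
  fixes s :: complex
  assumes "norm s < 1"
  shows "(\<lambda>n. of_real (rising a n) * s ^ n) sums (1 - s) powr (of_real (- a))"
proof -
  have "(\<lambda>n. (of_real (- a) gchoose n) * (- s) ^ n) sums (1 + - s) powr (of_real (- a))"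
    by (rule gen_binomial_complex) (use assms in simp)
  moreover have "(of_real (- a) gchoose n) * (- s) ^ n = of_real (rising a n) * s ^ n" for n
    by (simp add: gbinomial_pochhammer rising_def pochhammer_of_real power_minus[of s])
  ultimately show ?thesis by simp
qed

lemma rising_sums_real:
  fixes s :: real
  assumes "\<bar>s\<bar> < 1"
  shows "(\<lambda>n. rising a n * s ^ n) sums (1 - s) powr (- a)"
proof -
  have "(\<lambda>n. ((- a) gchoose n) * (- s) ^ n) sums (1 + - s) powr (- a)"
    by (rule gen_binomial_real) (use assms in simp)
  moreover have "((- a) gchoose n) * (- s) ^ n = rising a n * s ^ n" for n
    by (simp add: gbinomial_pochhammer rising_def power_minus[of s])
  ultimately show ?thesis by simp
qed

text \<open>A Cauchy estimate: all terms of the binomial series at \<open>s\<close> are nonnegative,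
  so each one is at most the sum.\<close>

lemma rising_le_powr:
  fixes s :: real
  assumes "0 \<le> a" "0 < s" "s < 1"
  shows "rising a n \<le> (1 - s) powr (- a) / s ^ n"
proof -
  have S: "(\<lambda>n. rising a n * s ^ n) sums (1 - s) powr (- a)"
    by (rule rising_sums_real) (use assms in auto)
  have "rising a n * s ^ n = (\<Sum>k\<in>{n}. rising a k * s ^ k)" by simp
  also have "\<dots> \<le> (\<Sum>k. rising a k * s ^ k)"
    by (rule sum_le_suminf) (use S assms rising_nonneg in \<open>auto simp: sums_iff\<close>)
  also have "\<dots> = (1 - s) powr (- a)" using S by (simp add: sums_iff)
  finally show ?thesis using assms by (simp add: field_simps)
qed

section \<open>Monotonicity and asymptotics of the scaled coefficients\<close>

lemma rising_mono:
  assumes "1 \<le> a" "m \<le> n"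
  shows "rising a m \<le> rising a n"
  using assms(2)
proof (induction rule: dec_induct)
  case (step n)
  have "rising a n * real (Suc n) \<le> rising a n * (a + real n)"
    using assms rising_nonneg[of a n] by (intro mult_left_mono) auto
  then have "rising a n \<le> rising a (Suc n)" by (simp add: rising_Suc field_simps)
  then show ?case using step by simp
qed simp

text \<open>With \<open>p = a - 1\<close>, consecutive coefficients have ratio
  \<open>1 + p / (n + 1)\<close>. This is at most \<open>((n + 1) / n) powr p\<close>, because
  \<open>1 / (n + 1) \<le> ln ((n + 1) / n)\<close> and \<open>1 + y \<le> exp y\<close>.\<close>

lemma rising_scaled_antimono:
  assumes "1 \<le> a" "0 < m" "m \<le> n"
  shows "real n powr (1 - a) * rising a n \<le> real m powr (1 - a) * rising a m"
  using assms(3)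
proof (induction rule: dec_induct)
  case (step n)
  have n: "0 < n" using step assms by simp
  define p where "p = a - 1"
  have p: "0 \<le> p" using assms by (simp add: p_def)
  have "ln (real n / real (Suc n)) \<le> real n / real (Suc n) - 1"
    using n by (intro ln_le_minus_one) auto
  then have l: "1 / real (Suc n) \<le> ln (real (Suc n) / real n)"
    using n by (simp add: ln_div field_simps)
  have "1 + p * (1 / real (Suc n)) \<le> 1 + p * ln (real (Suc n) / real n)"
    using p l by (intro add_left_mono mult_left_mono) auto
  also have "\<dots> \<le> (real (Suc n) / real n) powr p"
    using n exp_ge_add_one_self[of "p * ln (real (Suc n) / real n)"] by (simp add: powr_def)
  finally have "(a + real n) / real (Suc n) \<le> (real (Suc n) / real n) powr p"
    by (simp add: p_def field_simps)
  then have "(a + real n) / real (Suc n) \<le> real (Suc n) powr p / real n powr p"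
    by (simp add: powr_divide)
  then have "real (Suc n) powr (- p) * ((a + real n) / real (Suc n)) \<le> real n powr (- p)"
    using n by (simp add: powr_minus field_simps del: of_nat_Suc)
  then have "real (Suc n) powr (- p) * ((a + real n) / real (Suc n)) * rising a n \<le> real n powr (- p) * rising a n"
    by (rule mult_right_mono) (use assms rising_nonneg in auto)
  then have "real (Suc n) powr (1 - a) * rising a (Suc n) \<le> real n powr (1 - a) * rising a n"
    by (simp add: rising_Suc p_def mult_ac)
  then show ?case using step by simp
qed simp

lemma rising_scaled_le:
  assumes "1 \<le> a" "0 < N" "N \<le> n" "m \<le> n"
  shows "real n powr (1 - a) * rising a m \<le> real N powr (1 - a) * rising a N"
proof -
  have "real n powr (1 - a) * rising a m \<le> real n powr (1 - a) * rising a n"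
    using assms by (intro mult_left_mono rising_mono) auto
  also have "\<dots> \<le> real N powr (1 - a) * rising a N"
    using assms by (intro rising_scaled_antimono) auto
  finally show ?thesis .
qed

text \<open>Euler's product for \<open>rGamma\<close> has one Pochhammer factor more, namely
  \<open>a + n\<close>; the correction \<open>n / (a + n)\<close> tends to 1.\<close>

lemma rising_scaled_limit_aux:
  assumes "0 < a"
  shows "(\<lambda>n. real n powr (1 - a) * rising a n) \<longlonglongrightarrow> rGamma a"
proof -
  have "(\<lambda>n. rGamma_series a n * (real n / (a + real n))) \<longlonglongrightarrow> rGamma a * 1"
    by (intro tendsto_mult rGamma_series_LIMSEQ) real_asymp
  moreover have "eventually (\<lambda>n. rGamma_series a n * (real n / (a + real n)) =
      real n powr (1 - a) * rising a n) sequentially"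
    using eventually_gt_at_top[of 0]
  proof eventually_elim
    case (elim n)
    have "rGamma_series a n * (real n / (a + real n)) =
        pochhammer a n * ((a + real n) / (a + real n)) * real n / (fact n * exp (a * ln (real n)))"
      by (simp add: rGamma_series_def pochhammer_Suc)
    also have "\<dots> = real n powr (1 - a) * rising a n"
      using elim assms by (simp add: rising_def powr_diff powr_def[of _ a] mult_ac)
    finally show ?case .
  qed
  ultimately show ?thesis by (simp add: filterlim_cong)
qed

lemma rising_scaled_limit:
  assumes "0 < a"
  shows "(\<lambda>n. real n powr (1 - a) * rising a (n - k)) \<longlonglongrightarrow> rGamma a"
proof -
  have "(\<lambda>n. real (n + k) powr (1 - a) * rising a n) \<longlonglongrightarrow> rGamma a"
  proof -
    have "(\<lambda>n. (real n powr (1 - a) * rising a n) * (real (n + k) / real n) powr (1 - a)) \<longlonglongrightarrow> rGamma a * 1"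
    proof (intro tendsto_mult rising_scaled_limit_aux assms)
      have "(\<lambda>n. real (n + k) / real n) \<longlonglongrightarrow> 1" by real_asymp
      then have "(\<lambda>n. (real (n + k) / real n) powr (1 - a)) \<longlonglongrightarrow> 1 powr (1 - a)"
        by (intro tendsto_intros) auto
      then show "(\<lambda>n. (real (n + k) / real n) powr (1 - a)) \<longlonglongrightarrow> 1" by simp
    qed
    moreover have "eventually (\<lambda>n. (real n powr (1 - a) * rising a n) * (real (n + k) / real n) powr (1 - a)
      = real (n + k) powr (1 - a) * rising a n) sequentially"
      using eventually_gt_at_top[of 0] by eventually_elim (simp add: powr_divide)
    ultimately show ?thesis by (simp only: mult_1_right Lim_transform_eventually)
  qed
  then have "(\<lambda>n. real (n + k) powr (1 - a) * rising a (n + k - k)) \<longlonglongrightarrow> rGamma a" by simp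
  then show ?thesis by (rule LIMSEQ_offset[where k = k])
qed

text \<open>Pick \<open>q < r < 1\<close> and \<open>s\<close> with
  \<open>(1 - s) powr \<alpha> = r\<close>. Then \<open>rising_le_powr\<close> bounds the terms by a
  geometric series of ratio \<open>q / r\<close>.\<close>

lemma summable_rising_powser:
  fixes q :: real
  assumes "0 \<le> q" "q < 1" "0 < \<alpha>" "0 \<le> \<beta>"
  shows "summable (\<lambda>k. rising (\<alpha> * real k + \<beta>) n * q ^ k)"
proof -
  obtain r where r: "q < r" "r < 1" using assms dense by blast
  define s where "s = 1 - r powr (1 / \<alpha>)"
  have r1: "r powr (1 / \<alpha>) < 1" "0 < r powr (1 / \<alpha>)"
    using r assms powr_less_mono2[of "1 / \<alpha>" r 1] by auto
  then have s: "0 < s" "s < 1" by (auto simp: s_def)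
  have ra: "(1 - s) powr \<alpha> = r" using r assms by (simp add: s_def powr_powr)
  show ?thesis
  proof (rule summable_comparison_test')
    show "summable (\<lambda>k. (1 - s) powr (- \<beta>) / s ^ n * (q / r) ^ k)"
      using r assms by (intro summable_mult summable_geometric) auto
    fix k
    have "rising (\<alpha> * real k + \<beta>) n \<le> (1 - s) powr (- (\<alpha> * real k + \<beta>)) / s ^ n"
      using s assms by (intro rising_le_powr) auto
    also have "(1 - s) powr (- (\<alpha> * real k + \<beta>)) = (1 - s) powr (- \<beta>) * ((1 - s) powr \<alpha>) powr (- real k)"
      using s by (simp add: powr_powr algebra_simps flip: powr_add)
    also have "((1 - s) powr \<alpha>) powr (- real k) = 1 / r ^ k"
      unfolding ra using r assms by (simp add: powr_minus powr_realpow field_simps)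
    finally have "rising (\<alpha> * real k + \<beta>) n * q ^ k \<le> (1 - s) powr (- \<beta>) * (1 / r ^ k) / s ^ n * q ^ k"
      using assms by (intro mult_right_mono) auto
    then show "norm (rising (\<alpha> * real k + \<beta>) n * q ^ k) \<le> (1 - s) powr (- \<beta>) / s ^ n * (q / r) ^ k"
      using assms rising_nonneg[of "\<alpha> * real k + \<beta>" n] by (simp add: abs_mult power_divide mult_ac)
  qed
qed

text \<open>Tannery's theorem; the scaled coefficients are dominated by their values at a fixed large
  index because \<^term>\<open>real n powr (1 - a) * rising a n\<close> decreases in \<^term>\<open>n\<close>.\<close>

lemma mittag_leffler_limit:
  fixes z :: "'a::{real_normed_field,banach}"
  assumes "0 < \<alpha>" "1 \<le> \<beta>"
    and m: "\<And>n k. m n k \<le> n" and c: "\<And>n k. c n k \<in> {0..1}"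
    and ev: "\<And>k. \<forall>\<^sub>F n in sequentially. m n k = n - l k \<and> c n k = 1"
  shows "(\<lambda>n. of_real (real n powr (1 - \<beta>)) *
    (\<Sum>k. of_real (c n k * rising (\<alpha> * real k + \<beta>) (m n k)) * (z / of_real (real n powr \<alpha>)) ^ k)) \<longlonglongrightarrow>
     mittag_leffler \<alpha> \<beta> z"
proof -
  \<comment> \<open>The parameters \<open>m\<close> and \<open>c\<close> let one limit serve both
    schemes: \<open>m n k = n - k\<close> with a cutoff \<open>c\<close> for the forward one,
    \<open>m n k = n\<close> with \<open>c = 1\<close> for the backward one.\<close>
  define a where "a k n = of_real (c n k * (real n powr (1 - (\<alpha> * real k + \<beta>)) *
    rising (\<alpha> * real k + \<beta>) (m n k))) * z ^ k" for k n
  \<comment> \<open>\<open>N\<close> is the fixed index of the majorant \<open>M\<close>, taken so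
    large that \<open>norm z / N powr \<alpha> < 1\<close> and \<open>M\<close> is summable.\<close>
  obtain N where N: "norm z powr (1 / \<alpha>) < real N" "0 < N"
    by (metis gr0I of_nat_0 powr_ge_zero reals_Archimedean2 not_less)
  have zN: "norm z < real N powr \<alpha>"
  proof -
    have "norm z = (norm z powr (1 / \<alpha>)) powr \<alpha>" using assms by (simp add: powr_powr)
    also have "\<dots> < real N powr \<alpha>" using N assms by (intro powr_less_mono2) auto
    finally show ?thesis .
  qed
  define M where "M k = real N powr (1 - \<beta>) *
    (rising (\<alpha> * real k + \<beta>) N * (norm z / real N powr \<alpha>) ^ k)" for k
  have split: "real n powr (1 - (\<alpha> * real k + \<beta>)) = real n powr (1 - \<beta>) * (1 / real n powr \<alpha>) ^ k" if "0 < n" for n k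
  proof -
    have "real n powr (1 - (\<alpha> * real k + \<beta>)) = real n powr ((1 - \<beta>) + (- (\<alpha> * real k)))"
      by (simp add: algebra_simps)
    also have "\<dots> = real n powr (1 - \<beta>) * (1 / real n powr \<alpha>) ^ k"
      using that by (simp only: powr_add powr_minus)
        (simp add: powr_realpow[symmetric] powr_powr field_simps)
    finally show ?thesis .
  qed
  have lim: "(\<lambda>n. a k n) \<longlonglongrightarrow> of_real (rGamma (\<alpha> * real k + \<beta>)) * z ^ k" for k
  proof -
    have "(\<lambda>n. of_real (real n powr (1 - (\<alpha> * real k + \<beta>)) * rising (\<alpha> * real k + \<beta>) (n - l k)) * z ^ k)
        \<longlonglongrightarrow> of_real (rGamma (\<alpha> * real k + \<beta>)) * z ^ k"
      using assms(1,2) by (intro tendsto_intros rising_scaled_limit) (auto intro: add_nonneg_pos)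
    moreover have "\<forall>\<^sub>F n in sequentially. of_real (real n powr (1 - (\<alpha> * real k + \<beta>)) *
      rising (\<alpha> * real k + \<beta>) (n - l k)) * z ^ k = a k n"
      using ev[of k] by eventually_elim (simp add: a_def)
    ultimately show ?thesis by (rule Lim_transform_eventually)
  qed
  have bound: "norm (a k n) \<le> M k" if "N \<le> n" for k n
  proof -
    have x1: "1 \<le> \<alpha> * real k + \<beta>" using assms by (intro add_increasing) auto
    have "c n k * (real n powr (1 - (\<alpha> * real k + \<beta>)) * rising (\<alpha> * real k + \<beta>) (m n k))
      \<le> 1 * (real N powr (1 - (\<alpha> * real k + \<beta>)) * rising (\<alpha> * real k + \<beta>) N)"
      using x1 N that m c[of n k] rising_nonneg[of "\<alpha> * real k + \<beta>"]
      by (intro mult_mono rising_scaled_le) auto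
    then have "norm (a k n) \<le> real N powr (1 - (\<alpha> * real k + \<beta>)) * rising (\<alpha> * real k + \<beta>) N * norm z ^ k"
      using x1 c[of n k] rising_nonneg[of "\<alpha> * real k + \<beta>" "m n k"]
      by (auto simp: a_def norm_mult norm_power abs_mult intro!: mult_right_mono)
    then show ?thesis using N by (simp add: split M_def power_divide mult_ac)
  qed
  have sM: "summable M" unfolding M_def
    using zN N assms by (intro summable_mult summable_rising_powser) auto
  have "eventually (\<lambda>(k,n). norm (a k n) \<le> M k) (at_top \<times>\<^sub>F sequentially)"
    unfolding eventually_prod_filter case_prod_unfold
    by (rule exI[of _ "\<lambda>_. True"], rule exI[of _ "\<lambda>n. N \<le> n"]) (auto simp: bound)
  from tannerys_theorem[OF lim this sM]
  have T: "\<forall>\<^sub>F n in sequentially. summable (\<lambda>k. norm (a k n))"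
    "(\<lambda>n. \<Sum>k. a k n) \<longlonglongrightarrow> mittag_leffler \<alpha> \<beta> z"
    by (auto simp: mittag_leffler_def)
  have "\<forall>\<^sub>F n in sequentially. (\<Sum>k. a k n) = of_real (real n powr (1 - \<beta>)) *
    (\<Sum>k. of_real (c n k * rising (\<alpha> * real k + \<beta>) (m n k)) * (z / of_real (real n powr \<alpha>)) ^ k)"
    using T(1) eventually_gt_at_top[of 0]
  proof eventually_elim
    case (elim n)
    have n: "of_real (real n powr (1 - \<beta>)) \<noteq> (0::'a)" using elim by simp
    have eq: "a k n = of_real (real n powr (1 - \<beta>)) *
      (of_real (c n k * rising (\<alpha> * real k + \<beta>) (m n k)) * (z / of_real (real n powr \<alpha>)) ^ k)" for k
      using elim by (simp add: a_def split power_divide)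
    have "summable (\<lambda>k. a k n)" by (rule summable_norm_cancel) (rule elim)
    then have s: "summable (\<lambda>k. (of_real (c n k * rising (\<alpha> * real k + \<beta>) (m n k)) * (z / of_real (real n powr \<alpha>)) ^ k))"
      unfolding eq using n by (simp only: summable_cmult_iff) simp
    show ?case unfolding eq by (rule suminf_mult) (rule s)
  qed
  with T(2) show ?thesis by (rule Lim_transform_eventually)
qed

section \<open>The forward difference scheme\<close>

definition ml_poly :: "real \<Rightarrow> real \<Rightarrow> nat \<Rightarrow> 'a \<Rightarrow> 'a::{real_normed_field,banach}"
  where "ml_poly \<alpha> \<beta> n l = (\<Sum>k\<le>n. of_real (rising (\<alpha> * real k + \<beta>) (n - k)) * l ^ k)"

lemma ml_poly_of_real: "ml_poly \<alpha> \<beta> n (of_real x) = of_real (ml_poly \<alpha> \<beta> n x)"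
  by (simp add: ml_poly_def)

lemma ml_poly_limit:
  fixes z :: "'a::{real_normed_field,banach}"
  assumes "0 < \<alpha>" "1 \<le> \<beta>"
  shows "(\<lambda>n. of_real (real n powr (1 - \<beta>)) * ml_poly \<alpha> \<beta> n (z / of_real (real n powr \<alpha>)))
    \<longlonglongrightarrow> mittag_leffler \<alpha> \<beta> z"
proof -
  \<comment> \<open>For \<open>k > n\<close> the truncated difference \<open>n - k\<close> is 0 and
    \<open>rising\<close> would contribute 1, so the cutoff factor has to remove these
    terms.\<close>
  have "(\<Sum>k. of_real ((if k \<le> n then 1 else 0) * rising (\<alpha> * real k + \<beta>) (n - k)) * l ^ k) =
    ml_poly \<alpha> \<beta> n l" for n and l :: 'a
    unfolding ml_poly_def by (subst suminf_finite[of "{..n}"]) auto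
  moreover have "(\<lambda>n. of_real (real n powr (1 - \<beta>)) *
    (\<Sum>k. of_real ((if k \<le> n then 1 else 0) * rising (\<alpha> * real k + \<beta>) (n - k)) *
       (z / of_real (real n powr \<alpha>)) ^ k)) \<longlonglongrightarrow> mittag_leffler \<alpha> \<beta> z"
    by (rule mittag_leffler_limit[where l = "\<lambda>k. k"])
      (use assms in \<open>auto intro: eventually_mono[OF eventually_ge_at_top]\<close>)
  ultimately show ?thesis by simp
qed

text \<open>The generating function of \<^term>\<open>\<lambda>n. ml_poly \<alpha> \<beta> n l\<close> is
  \<open>(1 - s) powr (\<alpha> - \<beta>) / ((1 - s) powr \<alpha> - l * s)\<close>; multiplying out and comparing coefficients gives
  this convolution.\<close>

lemma ml_poly_convolution:
  fixes l :: "'a::{real_normed_field,banach}"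
  shows "(\<Sum>j\<le>Suc n. of_real (rising (- \<alpha>) j) * ml_poly \<alpha> \<beta> (Suc n - j) l) =
    of_real (rising (\<beta> - \<alpha>) (Suc n)) + l * ml_poly \<alpha> \<beta> n l"
proof -
  let ?N = "Suc n"
  have "(\<Sum>j\<le>?N. of_real (rising (- \<alpha>) j) * ml_poly \<alpha> \<beta> (?N - j) l) =
    (\<Sum>j\<le>?N. \<Sum>k\<le>?N - j. of_real (rising (- \<alpha>) j * rising (\<alpha> * real k + \<beta>) (?N - j - k)) * l ^ k)"
    by (simp add: ml_poly_def sum_distrib_left mult_ac)
  also have "\<dots> = (\<Sum>k\<le>?N. \<Sum>j\<le>?N - k. of_real (rising (- \<alpha>) j * rising (\<alpha> * real k + \<beta>) (?N - j - k)) * l ^ k)"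
    unfolding sum.Sigma[OF finite_atMost ballI[OF finite_atMost]]
    by (rule sum.reindex_bij_witness[of _ prod.swap prod.swap]) auto
  also have "\<dots> = (\<Sum>k\<le>?N. of_real (\<Sum>j\<le>?N - k. rising (- \<alpha>) j * rising (\<alpha> * real k + \<beta>) (?N - k - j)) * l ^ k)"
    unfolding of_real_sum sum_distrib_right by (intro sum.cong refl) (simp add: add.commute)
  also have "\<dots> = (\<Sum>k\<le>?N. of_real (rising (- \<alpha> + (\<alpha> * real k + \<beta>)) (?N - k)) * l ^ k)"
    by (simp only: rising_add)
  also have "\<dots> = of_real (rising (\<beta> - \<alpha>) ?N) + (\<Sum>k\<le>n. of_real (rising (\<alpha> * real k + \<beta>) (n - k)) * l ^ Suc k)"
    unfolding sum.atMost_Suc_shift by (simp add: algebra_simps)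
  also have "\<dots> = of_real (rising (\<beta> - \<alpha>) ?N) + l * ml_poly \<alpha> \<beta> n l"
    by (simp add: ml_poly_def sum_distrib_left mult_ac)
  finally show ?thesis .
qed

text \<open>The terms of the convolution with coefficients \<open>1\<close> and
  \<open>- \<alpha>\<close> are taken out of the sum. The signs are arranged so that everything
  subtracted has a nonnegative coefficient when \<open>1 \<le> \<alpha> \<le> 2\<close> and
  \<open>- 1 \<le> \<beta> - \<alpha> \<le> 0\<close>.\<close>

lemma ml_poly_Suc:
  fixes l :: "'a::{real_normed_field,banach}"
  shows "ml_poly \<alpha> \<beta> (Suc n) l = (l + of_real \<alpha>) * ml_poly \<alpha> \<beta> n l -
    (\<Sum>j<n. of_real (rising (- \<alpha>) (Suc (n - j))) * ml_poly \<alpha> \<beta> j l) - of_real (- rising (\<beta> - \<alpha>) (Suc n))"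
proof -
  have "(\<Sum>j\<le>Suc n. of_real (rising (- \<alpha>) j) * ml_poly \<alpha> \<beta> (Suc n - j) l) =
    (\<Sum>j\<le>Suc n. of_real (rising (- \<alpha>) (Suc n - j)) * ml_poly \<alpha> \<beta> j l)"
    by (rule sum.reindex_bij_witness[of _ "\<lambda>j. Suc n - j" "\<lambda>j. Suc n - j"]) auto
  also have "\<dots> = (\<Sum>j<n. of_real (rising (- \<alpha>) (Suc (n - j))) * ml_poly \<alpha> \<beta> j l) -
     of_real \<alpha> * ml_poly \<alpha> \<beta> n l + ml_poly \<alpha> \<beta> (Suc n) l"
    by (simp add: lessThan_Suc_atMost[symmetric] Suc_diff_le)
  finally show ?thesis using ml_poly_convolution[of \<alpha> \<beta> n l] by (simp add: algebra_simps)
qed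

lemma ml_poly_pos:
  fixes x :: real
  assumes "0 < \<alpha>" "0 < \<beta>" "0 \<le> x"
  shows "0 < ml_poly \<alpha> \<beta> n x"
proof -
  have "0 < rising (\<alpha> * real 0 + \<beta>) (n - 0) * x ^ 0"
    using assms by (simp add: rising_pos)
  then show ?thesis unfolding ml_poly_def
    by (intro sum_pos2[where i = 0]) (use assms in \<open>auto intro!: mult_nonneg_nonneg rising_nonneg\<close>)
qed

text \<open>Skip-free recurrences: subtracting nonnegative multiples of earlier terms can only
  improve the ratio \<open>norm (u n) / v n\<close>, which is therefore nondecreasing.\<close>

lemma norm_ge_of_recurrence:
  fixes u :: "nat \<Rightarrow> complex" and v :: "nat \<Rightarrow> real"
  assumes pos: "\<And>n. 0 < v n" and init: "u 0 = 1" "v 0 = 1"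
    and c: "\<And>n j. j < n \<Longrightarrow> 0 \<le> c n j" and g: "\<And>n. 0 \<le> g n" and p: "p \<le> norm q"
    and u: "\<And>n. u (Suc n) = q * u n - (\<Sum>j<n. of_real (c n j) * u j) - of_real (g n)"
    and v: "\<And>n. v (Suc n) = p * v n - (\<Sum>j<n. c n j * v j) - g n"
  shows "v n \<le> norm (u n)"
proof -
  define r where "r n = norm (u n) / v n" for n
  have ur: "norm (u n) = r n * v n" for n using pos[of n] by (simp add: r_def)
  \<comment> \<open>The induction carries the bound on all earlier ratios, because the recurrence
    reaches back to every \<open>j < n\<close>.\<close>
  have mono: "r n \<le> r (Suc n) \<and> (\<forall>j\<le>Suc n. r j \<le> r (Suc n)) \<and> 1 \<le> r (Suc n)" for n
  proof (induction n rule: less_induct)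
    case (less n)
    have IH: "\<forall>j\<le>n. r j \<le> r n" "1 \<le> r n"
    proof -
      show "\<forall>j\<le>n. r j \<le> r n" by (cases n) (use less in auto)
      show "1 \<le> r n" by (cases n) (use less init in \<open>auto simp: r_def\<close>)
    qed
    \<comment> \<open>The recurrence for \<open>v\<close>, multiplied by \<open>r n\<close>, is
      compared term by term with the one for \<open>u\<close>: \<open>r j \<le> r n\<close> handles
      the sum and \<open>1 \<le> r n\<close> handles \<open>g n\<close>.\<close>
    have "r n * v (Suc n) = r n * (p * v n) - (\<Sum>j<n. c n j * (r n * v j)) - r n * g n"
      by (simp add: v algebra_simps sum_distrib_left)
    also have "\<dots> \<le> norm q * norm (u n) - (\<Sum>j<n. c n j * norm (u j)) - g n"
    proof (intro diff_mono)
      show "r n * (p * v n) \<le> norm q * norm (u n)"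
        using p pos[of n] IH(2) by (simp add: ur mult_ac mult_left_mono)
      show "(\<Sum>j<n. c n j * norm (u j)) \<le> (\<Sum>j<n. c n j * (r n * v j))"
        unfolding ur using IH(1) pos c by (intro sum_mono mult_left_mono mult_right_mono) (auto simp: less_imp_le)
      show "g n \<le> r n * g n" using IH(2) g[of n] by (simp add: mult_le_cancel_right1)
    qed
    also have "\<dots> \<le> norm (u (Suc n))"
    proof -
      have "norm (\<Sum>j<n. of_real (c n j) * u j) \<le> (\<Sum>j<n. c n j * norm (u j))"
        by (rule sum_norm_le) (use c in \<open>auto simp: norm_mult\<close>)
      moreover have "norm (q * u n) - norm (\<Sum>j<n. of_real (c n j) * u j) - norm (of_real (g n) :: complex)
        \<le> norm (u (Suc n))"
        unfolding u by (smt (verit) norm_triangle_ineq2)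
      ultimately show ?thesis using g[of n] by (simp add: norm_mult)
    qed
    finally have "r n \<le> r (Suc n)" using pos[of "Suc n"] by (simp add: ur)
    then show ?case using IH by (auto simp: le_Suc_eq intro: order_trans)
  qed
  have "1 \<le> r n" by (cases n) (use mono init in \<open>auto simp: r_def\<close>)
  then show ?thesis using pos[of n] by (simp add: r_def)
qed

lemma ml_poly_norm_ge:
  assumes "1 \<le> \<alpha>" "\<alpha> \<le> 2" "1 \<le> \<beta>" "\<beta> \<le> \<alpha>" "0 \<le> Re l"
  shows "ml_poly \<alpha> \<beta> n (Re l) \<le> norm (ml_poly \<alpha> \<beta> n l)"
proof (rule norm_ge_of_recurrence[where q = "l + of_real \<alpha>" and p = "Re l + \<alpha>"
      and c = "\<lambda>n j. rising (- \<alpha>) (Suc (n - j))" and g = "\<lambda>n. - rising (\<beta> - \<alpha>) (Suc n)"])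
  show "0 \<le> rising (- \<alpha>) (Suc (n - j))" if "j < n" for n j
    using that assms rising_nonneg_Suc_Suc[of "- \<alpha>" "n - Suc j"] by (simp add: Suc_diff_Suc)
  show "0 \<le> - rising (\<beta> - \<alpha>) (Suc n)" for n
    using rising_nonpos[of "\<beta> - \<alpha>" n] assms by simp
  show "Re l + \<alpha> \<le> norm (l + of_real \<alpha>)"
    using complex_Re_le_cmod[of "l + of_real \<alpha>"] by simp
  show "0 < ml_poly \<alpha> \<beta> n (Re l)" for n using assms by (intro ml_poly_pos) auto
  show "ml_poly \<alpha> \<beta> (Suc n) l = (l + of_real \<alpha>) * ml_poly \<alpha> \<beta> n l -
    (\<Sum>j<n. of_real (rising (- \<alpha>) (Suc (n - j))) * ml_poly \<alpha> \<beta> j l) - of_real (- rising (\<beta> - \<alpha>) (Suc n))" for n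
    by (rule ml_poly_Suc)
  show "ml_poly \<alpha> \<beta> (Suc n) (Re l) = (Re l + \<alpha>) * ml_poly \<alpha> \<beta> n (Re l) -
    (\<Sum>j<n. rising (- \<alpha>) (Suc (n - j)) * ml_poly \<alpha> \<beta> j (Re l)) - - rising (\<beta> - \<alpha>) (Suc n)" for n
    using ml_poly_Suc[of \<alpha> \<beta> n "Re l"] by simp
qed (simp_all add: ml_poly_def)

text \<open>The hypothesis concerns only those \<open>l\<close> whose real part is a rescaling of
  \<open>Re z\<close>, so that a sign condition on \<open>Re z\<close> passes to the discrete
  problem.\<close>

lemma mittag_leffler_ge_of_ml_poly_ge:
  assumes "0 < \<alpha>" "1 \<le> \<beta>"
    and ge: "\<And>n l. Re l = Re z / real n powr \<alpha> \<Longrightarrow> ml_poly \<alpha> \<beta> n (Re l) \<le> norm (ml_poly \<alpha> \<beta> n l)"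
  shows "mittag_leffler \<alpha> \<beta> (Re z) \<le> norm (mittag_leffler \<alpha> \<beta> z)"
proof (rule LIMSEQ_le)
  show "(\<lambda>n. real n powr (1 - \<beta>) * ml_poly \<alpha> \<beta> n (Re z / real n powr \<alpha>)) \<longlonglongrightarrow> mittag_leffler \<alpha> \<beta> (Re z)"
    using ml_poly_limit[OF assms(1,2), of "Re z"] by simp
  show "(\<lambda>n. norm (of_real (real n powr (1 - \<beta>)) * ml_poly \<alpha> \<beta> n (z / of_real (real n powr \<alpha>))))
    \<longlonglongrightarrow> norm (mittag_leffler \<alpha> \<beta> z)"
    by (intro tendsto_norm ml_poly_limit assms)
  show "\<exists>N. \<forall>n\<ge>N. real n powr (1 - \<beta>) * ml_poly \<alpha> \<beta> n (Re z / real n powr \<alpha>) \<le>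
     norm (of_real (real n powr (1 - \<beta>)) * ml_poly \<alpha> \<beta> n (z / of_real (real n powr \<alpha>)))"
    using ge[of "z / of_real (real _ powr \<alpha>)"] by (auto simp: norm_mult intro!: mult_left_mono exI[of _ 0])
qed

section \<open>Real-rootedness for \<open>\<alpha> = 2\<close>\<close>

lemma poly_eq_prod_roots:
  fixes p :: "complex poly"
  shows "poly p z = lead_coeff p * (\<Prod>r\<in>#proots p. z - r)"
proof -
  have "poly (\<Prod>r\<in>#A. [:-r, 1:]) z = (\<Prod>r\<in>#A. z - r)" for A
    by (induction A) (auto simp: algebra_simps)
  then show ?thesis by (subst complex_poly_decompose_multiset[symmetric]) simp
qed


section \<open>Zero-free truncations in the unit disc and reversed polynomials\<close>

lemma sum_atMost_rising: "(\<Sum>j\<le>n. rising a j) = rising (a + 1) n"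
proof -
  have "rising 1 m = 1" for m by (simp add: rising_def flip: pochhammer_fact)
  then show ?thesis by (simp add: rising_add)
qed

text \<open>The coefficients after the constant 1 have absolute values of sum at most 1, and each
  carries at least one factor \<open>s\<close>; together these terms have modulus at most
  \<open>norm s < 1\<close>.\<close>

lemma powser_nonzero_of_dominant_constant:
  fixes c :: "nat \<Rightarrow> real" and s :: complex
  assumes "c 0 = 1" and c: "\<And>j. 0 < j \<Longrightarrow> c j \<le> 0" and "0 \<le> (\<Sum>j\<le>m. c j)" and s: "norm s < 1"
  shows "(\<Sum>j\<le>m. of_real (c j) * s ^ j) \<noteq> 0"
proof
  assume z: "(\<Sum>j\<le>m. of_real (c j) * s ^ j) = 0"
  have sp: "(\<Sum>j\<le>m. f j) = f 0 + (\<Sum>j=1..m. f j)" for f :: "nat \<Rightarrow> 'b::comm_monoid_add"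
    by (simp add: atMost_atLeast0 sum.atLeast_Suc_atMost)
  have "1 = norm (\<Sum>j=1..m. of_real (c j) * s ^ j)"
    using z assms(1) unfolding sp by (metis add_eq_0_iff norm_minus_cancel norm_one mult.right_neutral of_real_1 power_0)
  also have "\<dots> \<le> (\<Sum>j=1..m. - c j * norm s)"
  proof (rule sum_norm_le)
    fix j assume j: "j \<in> {1..m}"
    have "norm s ^ j \<le> norm s ^ 1" using j s by (intro power_decreasing) auto
    then show "norm (of_real (c j) * s ^ j) \<le> - c j * norm s"
      using c[of j] j by (simp add: norm_mult norm_power mult_left_mono_neg)
  qed
  also have "\<dots> = (\<Sum>j=1..m. - c j) * norm s" by (simp add: sum_distrib_right)
  also have "\<dots> \<le> 1 * norm s"
    using assms(3) \<open>c 0 = 1\<close> unfolding sp by (intro mult_right_mono) (auto simp: sum_negf)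
  finally show False using s by simp
qed

text \<open>For \<open>d \<le> 0\<close> the constant term dominates at once, the coefficient sum
  being \<open>rising (d + 1) n\<close>. For \<open>d > 0\<close> it dominates after multiplication
  by \<open>1 - s\<close>, as in the Enestroem-Kakeya theorem.\<close>

lemma truncated_binomial_nonzero:
  fixes s :: complex
  assumes d: "- 1 \<le> d" "d \<le> 1" and s: "norm s < 1"
  shows "(\<Sum>j\<le>n. of_real (rising d j) * s ^ j) \<noteq> 0"
proof (cases "d \<le> 0")
  case True
  show ?thesis
  proof (rule powser_nonzero_of_dominant_constant)
    show "rising d j \<le> 0" if "0 < j" for j
      using that d True rising_nonpos[of d "j - 1"] by simp
    show "0 \<le> (\<Sum>j\<le>n. rising d j)"
      using d by (simp add: sum_atMost_rising rising_nonneg)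
  qed (use s in auto)
next
  case False
  \<comment> \<open>The coefficients of \<open>1 - s\<close> times the truncated series: differences
    of neighbouring \<open>rising d\<close> values, and the leftover \<open>- rising d n\<close> at
    index \<open>n + 1\<close>. They add up to 0, the value at \<open>s = 1\<close>.\<close>
  define c where "c j = (if j \<le> n then rising (d - 1) j else - rising d n)" for j
  have c: "(\<Sum>j\<le>Suc n. f (c j) j) = (\<Sum>j\<le>n. f (rising (d - 1) j) j) + f (- rising d n) (Suc n)"
    for f :: "real \<Rightarrow> nat \<Rightarrow> 'b::comm_monoid_add"
    by (simp add: c_def)
  have "(\<Sum>j\<le>Suc n. of_real (c j) * s ^ j) \<noteq> 0"
  proof (rule powser_nonzero_of_dominant_constant)
    show "c j \<le> 0" if "0 < j" for j
      using that d False rising_nonpos[of "d - 1" "j - 1"] rising_nonneg[of d n] by (simp add: c_def)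
    show "0 \<le> (\<Sum>j\<le>Suc n. c j)"
      unfolding c[of "\<lambda>x _. x"] by (simp add: sum_atMost_rising)
  qed (use s in \<open>auto simp: c_def\<close>)
  also have "(\<Sum>j\<le>Suc n. of_real (c j) * s ^ j) =
    (\<Sum>j\<le>n. of_real (rising (d - 1) j) * s ^ j) - of_real (rising d n) * s ^ Suc n"
    by (simp only: c[of "\<lambda>x j. of_real x * s ^ j"]) simp
  also have "\<dots> = (1 - s) * (\<Sum>j\<le>n. of_real (rising d j) * s ^ j)"
  proof (induction n)
    case (Suc n)
    have "rising (d - 1) (Suc n) = rising d (Suc n) - rising d n"
      using sum_atMost_rising[of "d - 1" n] sum_atMost_rising[of "d - 1" "Suc n"] by simp
    then show ?case using Suc by (simp add: ring_distribs mult_ac)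
  qed simp
  finally show ?thesis by auto
qed

text \<open>Factor by factor, \<open>(1 - |x|^2) * (|r|^2 - 1) \<ge> 0\<close> says
  \<open>|1 - r * x| \<le> |cnj x - r|\<close> for every root \<open>r\<close>. The symmetry under
  \<open>cnj\<close> replaces \<open>cnj x\<close> by \<open>x\<close>, and powers of
  \<open>x\<close> beyond the degree only shrink the left side.\<close>

lemma norm_reversed_poly_le:
  fixes p :: "complex poly"
  assumes real: "\<And>z. poly p (cnj z) = cnj (poly p z)"
    and roots: "\<And>z. poly p z = 0 \<Longrightarrow> 1 \<le> norm z"
    and "degree p \<le> n" "norm x < 1" "x \<noteq> 0"
  shows "norm (x ^ n * poly p (1 / x)) \<le> norm (poly p x)"
proof (cases "p = 0")
  case False
  define A where "A = proots p"
  have A: "size A = degree p" by (simp add: A_def size_proots_complex)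
  have ev: "poly p z = lead_coeff p * (\<Prod>r\<in>#A. z - r)" for z
    unfolding A_def by (rule poly_eq_prod_roots)
  have A1: "1 \<le> norm r" if "r \<in># A" for r
    by (rule roots) (use that False in \<open>simp add: A_def\<close>)
  have fac: "norm (1 - r * x) \<le> norm (cnj x - r)" if "1 \<le> norm r" for r
  proof -
    have "(1 - (norm x)\<^sup>2) * ((norm r)\<^sup>2 - 1) \<ge> 0"
      using that \<open>norm x < 1\<close> by (intro mult_nonneg_nonneg) (auto simp: power_le_one)
    moreover have "(norm (cnj x - r))\<^sup>2 - (norm (1 - r * x))\<^sup>2 = (1 - (norm x)\<^sup>2) * ((norm r)\<^sup>2 - 1)"
      unfolding cmod_power2 by (simp add: power2_eq_square algebra_simps)
    ultimately have "(norm (1 - r * x))\<^sup>2 \<le> (norm (cnj x - r))\<^sup>2" by linarith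
    then show ?thesis by (rule power2_le_imp_le) simp
  qed
  have "norm (x ^ n * poly p (1 / x)) = norm x ^ n * norm (poly p (1 / x))"
    by (simp add: norm_mult norm_power)
  also have "\<dots> \<le> norm x ^ size A * norm (poly p (1 / x))"
    using assms A by (intro mult_right_mono power_decreasing) auto
  also have "\<dots> = norm (lead_coeff p) * (norm x ^ size A * norm (\<Prod>r\<in>#A. 1 / x - r))"
    by (simp add: ev norm_mult)
  also have "norm x ^ size A * norm (\<Prod>r\<in>#A. 1 / x - r) = norm (\<Prod>r\<in>#A. 1 - r * x)"
  proof (induction A)
    case (add r A)
    have "norm x ^ size (add_mset r A) * norm (\<Prod>r\<in>#add_mset r A. 1 / x - r) =
        norm (x * (1 / x - r)) * (norm x ^ size A * norm (\<Prod>r\<in>#A. 1 / x - r))"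
      by (simp add: norm_mult mult_ac)
    also have "x * (1 / x - r) = 1 - r * x" using \<open>x \<noteq> 0\<close> by (simp add: field_simps)
    finally show ?case using add by (simp add: norm_mult)
  qed simp
  also have "\<dots> \<le> norm (\<Prod>r\<in>#A. cnj x - r)"
    using A1
  proof (induction A)
    case (add r A)
    then show ?case using fac[of r] by (auto simp: norm_mult intro!: mult_mono)
  qed simp
  also have "norm (lead_coeff p) * norm (\<Prod>r\<in>#A. cnj x - r) = norm (poly p x)"
    by (simp add: real flip: norm_mult ev)
  finally show ?thesis by (simp add: mult_left_mono)
qed simp

text \<open>For a real root \<open>r\<close> the factor \<open>Re z - r\<close> is the real part of
  \<open>z - r\<close>.\<close>

lemma norm_poly_Re_le:
  fixes p :: "complex poly"
  assumes roots: "\<And>z. poly p z = 0 \<Longrightarrow> z \<in> \<real>"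
  shows "norm (poly p (of_real (Re z))) \<le> norm (poly p z)"
proof (cases "p = 0")
  case False
  define A where "A = proots p"
  have ev: "poly p z = lead_coeff p * (\<Prod>r\<in>#A. z - r)" for z
    unfolding A_def by (rule poly_eq_prod_roots)
  have "r \<in> \<real>" if "r \<in># A" for r
    by (rule roots) (use that False in \<open>simp add: A_def\<close>)
  then have "norm (\<Prod>r\<in>#A. of_real (Re z) - r) \<le> norm (\<Prod>r\<in>#A. z - r)"
  proof (induction A)
    case (add r A)
    have "of_real (Re r) = r" using add.prems by (intro of_real_Re) simp
    then have "of_real (Re z) - r = of_real (Re (z - r))" by (metis minus_complex.simps(1) of_real_diff)
    then have "norm (of_real (Re z) - r) = \<bar>Re (z - r)\<bar>" by (simp only: norm_of_real)
    then have "norm (of_real (Re z) - r) \<le> norm (z - r)" by (simp only: abs_Re_le_cmod)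
    then show ?case using add by (auto simp: norm_mult intro!: mult_mono)
  qed simp
  then show ?thesis by (simp add: ev norm_mult mult_left_mono)
qed simp

text \<open>With \<open>l = x + 1 / x - 2\<close> the denominator \<open>(1 - s)\<^sup>2 - l * s\<close> of the generating function factors
  as \<open>(1 - x * s) * (1 - s / x)\<close>.\<close>

lemma ml_poly_2_eq:
  fixes x y l :: complex
  assumes xy: "x * y = 1" and l: "l = x + y - 2"
  shows "(x - y) * ml_poly 2 \<beta> n l =
    (\<Sum>j\<le>n. of_real (rising (\<beta> - 2) j) * (x ^ Suc (n - j) - y ^ Suc (n - j)))"
proof (induction n rule: induct_nat_012)
  case 0
  show ?case by (simp add: ml_poly_def)
next
  case 1
  have "ml_poly 2 \<beta> (Suc 0) (x + y - 2) = of_real \<beta> + (x + y - 2)" by (simp add: ml_poly_def)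
  then show ?case unfolding l by (simp only:) (simp add: algebra_simps)
next
  case (ge2 n)
  let ?T = "\<lambda>m. x ^ m - y ^ m"
  let ?g = "\<lambda>j. of_real (rising (\<beta> - 2) j) :: complex"
  \<comment> \<open>Since \<open>x * y = 1\<close>, the powers of \<open>x\<close> and of
    \<open>y\<close> both solve the three-term recurrence with middle coefficient
    \<open>x + y\<close>.\<close>
  have T: "?T (Suc (Suc m)) = (x + y) * ?T (Suc m) - ?T m" for m
  proof -
    have "y * x ^ Suc m = (x * y) * x ^ m" "x * y ^ Suc m = (x * y) * y ^ m"
      by simp_all
    then have *: "y * x ^ Suc m = x ^ m" "x * y ^ Suc m = y ^ m"
      unfolding xy by simp_all
    have "(x + y) * ?T (Suc m) = x * x ^ Suc m + y * x ^ Suc m - (x * y ^ Suc m + y * y ^ Suc m)"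
      by (simp only: distrib_right right_diff_distrib)
    then show ?thesis unfolding * by simp
  qed
  \<comment> \<open>\<open>(1 - s) ^ 2\<close> has no coefficients beyond \<open>s ^ 2\<close>, so
    the full-history recurrence collapses to three terms.\<close>
  have z: "rising (- 2) (Suc (Suc (Suc k))) = 0" for k
    by (induction k) (simp_all add: rising_Suc)
  have r2: "rising (- 2) (Suc (Suc 0)) = 1" by (simp add: rising_Suc)
  have "(\<Sum>j<Suc n. of_real (rising (- 2) (Suc (Suc n - j))) * ml_poly 2 \<beta> j l) =
    (\<Sum>j<n. of_real (rising (- 2) (Suc (Suc n - j))) * ml_poly 2 \<beta> j l) + ml_poly 2 \<beta> n l"
    by (simp add: r2)
  also have "(\<Sum>j<n. of_real (rising (- 2) (Suc (Suc n - j))) * ml_poly 2 \<beta> j l) = 0"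
  proof (rule sum.neutral, rule ballI)
    fix j assume "j \<in> {..<n}"
    then have "Suc (Suc n - j) = Suc (Suc (Suc (n - Suc j)))" by simp
    then show "of_real (rising (- 2) (Suc (Suc n - j))) * ml_poly 2 \<beta> j l = 0" by (simp only: z) simp
  qed
  finally have rec: "ml_poly 2 \<beta> (Suc (Suc n)) l = (x + y) * ml_poly 2 \<beta> (Suc n) l - ml_poly 2 \<beta> n l + ?g (Suc (Suc n))"
    by (subst ml_poly_Suc) (simp add: l)
  have "(x - y) * ml_poly 2 \<beta> (Suc (Suc n)) l =
    (x + y) * ((x - y) * ml_poly 2 \<beta> (Suc n) l) - (x - y) * ml_poly 2 \<beta> n l + ?g (Suc (Suc n)) * (x - y)"
    unfolding rec by (simp add: algebra_simps)
  also have "\<dots> = (x + y) * (\<Sum>j\<le>Suc n. ?g j * ?T (Suc (Suc n - j))) - (\<Sum>j\<le>n. ?g j * ?T (Suc (n - j)))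
      + ?g (Suc (Suc n)) * (x - y)"
    by (simp only: ge2)
  also have "\<dots> = (\<Sum>j\<le>n. ?g j * ((x + y) * ?T (Suc (Suc n - j)) - ?T (Suc (n - j))))
      + ?g (Suc n) * ((x + y) * ?T (Suc 0)) + ?g (Suc (Suc n)) * (x - y)"
  proof -
    have lin: "(\<Sum>j\<le>n. ?g j * ((x + y) * a j - b j)) = (x + y) * (\<Sum>j\<le>n. ?g j * a j) - (\<Sum>j\<le>n. ?g j * b j)"
      for a b :: "nat \<Rightarrow> complex"
      by (simp only: right_diff_distrib sum_subtractf sum_distrib_left mult.left_commute)
    show ?thesis unfolding lin sum.atMost_Suc by (simp add: algebra_simps)
  qed
  also have "(\<Sum>j\<le>n. ?g j * ((x + y) * ?T (Suc (Suc n - j)) - ?T (Suc (n - j)))) =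
    (\<Sum>j\<le>n. ?g j * ?T (Suc (Suc (Suc n) - j)))"
  proof (rule sum.cong[OF refl])
    fix j assume "j \<in> {..n}"
    then have "Suc (Suc (Suc n) - j) = Suc (Suc (Suc (n - j)))" "Suc (Suc n - j) = Suc (Suc (n - j))" by auto
    then show "?g j * ((x + y) * ?T (Suc (Suc n - j)) - ?T (Suc (n - j))) = ?g j * ?T (Suc (Suc (Suc n) - j))"
      by (simp only: T)
  qed
  also have "(x + y) * ?T (Suc 0) = ?T (Suc (Suc 0))"
    using T[of 0] by simp
  finally show ?case by simp
qed

text \<open>Write \<open>l = x + 1 / x - 2\<close> with \<open>norm x \<le> 1\<close>. On the unit
  circle \<open>l = 2 * Re x - 2\<close> is real. Inside, a zero would force
  \<open>p(x) = x ^ (n + 2) * (x ^ n * p(1 / x))\<close> for the truncated binomial series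
  \<open>p\<close>. As \<open>p\<close> has no zero in the disc, the bound for reversed polynomials
  rules this out.\<close>

lemma ml_poly_2_root_real:
  assumes "1 \<le> \<beta>" "\<beta> \<le> 3" and zero: "ml_poly 2 \<beta> n (l :: complex) = 0"
  shows "l \<in> \<real>"
proof -
  have "\<exists>x. x \<noteq> 0 \<and> x + 1 / x = l + 2"
  proof -
    \<comment> \<open>The roots of \<open>x ^ 2 - (l + 2) * x + 1\<close> have product 1, so the
      other root is \<open>1 / x\<close>.\<close>
    let ?d = "csqrt ((l + 2)\<^sup>2 - 4)"
    let ?x = "(l + 2 + ?d) / 2"
    have "?x * ((l + 2 - ?d) / 2) = ((l + 2)\<^sup>2 - ?d\<^sup>2) / 4" by (simp add: power2_eq_square algebra_simps)
    also have "\<dots> = 1" by simp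
    finally have x: "?x * ((l + 2 - ?d) / 2) = 1" .
    then have "?x \<noteq> 0" by force
    moreover from x have "1 / ?x = (l + 2 - ?d) / 2" by (metis calculation nonzero_mult_div_cancel_left)
    then have "?x + 1 / ?x = l + 2" by (simp add: field_simps)
    ultimately show ?thesis by blast
  qed
  then obtain x0 where x0: "x0 \<noteq> 0" "x0 + 1 / x0 = l + 2" by blast
  obtain x where x: "x \<noteq> 0" "x + 1 / x = l + 2" "norm x \<le> 1"
  proof (cases "norm x0 \<le> 1")
    case True
    with x0 that show ?thesis by blast
  next
    case False
    then show ?thesis using x0 by (intro that[of "1 / x0"]) (auto simp: norm_divide add.commute)
  qed
  have l: "l = x + 1 / x - 2" using x(2) by (simp add: algebra_simps)
  show ?thesis
  proof (cases "norm x = 1")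
    case True
    then have "x * cnj x = 1" by (metis complex_norm_square of_real_1 one_power2)
    then have "1 / x = cnj x" using x(1) by (simp add: field_simps)
    then have "l = of_real (2 * Re x - 2)" unfolding l by (simp add: complex_eq_iff)
    then show ?thesis by simp
  next
    case False
    then have x1: "norm x < 1" using x by simp
    define p where "p = (\<Sum>j\<le>n. monom (complex_of_real (rising (\<beta> - 2) j)) j)"
    have p: "poly p s = (\<Sum>j\<le>n. of_real (rising (\<beta> - 2) j) * s ^ j)" for s
      by (simp add: p_def poly_sum poly_monom)
    have nz: "poly p s \<noteq> 0" if "norm s < 1" for s
      unfolding p using that assms by (intro truncated_binomial_nonzero) auto
    have rev: "norm (x ^ n * poly p (1 / x)) \<le> norm (poly p x)"
    proof (rule norm_reversed_poly_le)
      show "degree p \<le> n" unfolding p_def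
        by (rule degree_sum_le) (auto intro: order_trans[OF degree_monom_le])
    qed (use x x1 nz in \<open>auto simp: p not_less[symmetric]\<close>)
    have pw: "x ^ Suc n * (1 / x) ^ j = x ^ Suc (n - j)" "(1 / x) ^ Suc n * x ^ j = (1 / x) ^ Suc (n - j)" if "j \<le> n" for j
      using that x(1) by (simp_all add: power_divide power_diff field_simps)
    have "0 = (\<Sum>j\<le>n. of_real (rising (\<beta> - 2) j) * (x ^ Suc (n - j) - (1 / x) ^ Suc (n - j)))"
      using ml_poly_2_eq[of x "1 / x" l \<beta> n] x(1) zero l by simp
    also have "\<dots> = x ^ Suc n * poly p (1 / x) - (1 / x) ^ Suc n * poly p x"
      unfolding p sum_distrib_left sum_subtractf[symmetric]
    proof (rule sum.cong[OF refl])
      fix j assume "j \<in> {..n}"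
      then have "j \<le> n" by simp
      then show "of_real (rising (\<beta> - 2) j) * (x ^ Suc (n - j) - (1 / x) ^ Suc (n - j)) =
        x ^ Suc n * (of_real (rising (\<beta> - 2) j) * (1 / x) ^ j) - (1 / x) ^ Suc n * (of_real (rising (\<beta> - 2) j) * x ^ j)"
        by (simp only: right_diff_distrib mult.left_commute flip: pw)
    qed
    finally have "poly p x = x ^ (n + 2) * (x ^ n * poly p (1 / x))"
      using x(1) by (simp add: power_divide field_simps flip: power_add)
    then have "norm (poly p x) = norm x ^ (n + 2) * norm (x ^ n * poly p (1 / x))"
      by (metis norm_mult norm_power)
    also have "\<dots> \<le> norm x ^ (n + 2) * norm (poly p x)"
      using rev by (intro mult_left_mono) auto
    finally have "1 \<le> norm x ^ (n + 2)" using nz[OF x1] by simp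
    moreover have "norm x ^ (n + 2) < 1" using x1 by (subst power_less_one_iff) auto
    ultimately show ?thesis by simp
  qed
qed

lemma ml_poly_2_norm_ge:
  assumes "1 \<le> \<beta>" "\<beta> \<le> 3"
  shows "ml_poly 2 \<beta> n (Re l) \<le> norm (ml_poly 2 \<beta> n l)"
proof -
  define p where "p = (\<Sum>k\<le>n. monom (complex_of_real (rising (2 * real k + \<beta>) (n - k))) k)"
  have p: "poly p z = ml_poly 2 \<beta> n z" for z
    by (simp add: p_def ml_poly_def poly_sum poly_monom)
  have "norm (poly p (of_real (Re l))) \<le> norm (poly p l)"
    by (rule norm_poly_Re_le) (use ml_poly_2_root_real[OF assms] in \<open>auto simp: p\<close>)
  then show ?thesis by (simp add: p ml_poly_of_real)
qed

section \<open>The contour integral\<close>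

lemma contour_integral_linepath_horizontal:
  assumes "a < b"
  shows "contour_integral (linepath (Complex a y) (Complex b y)) f =
    integral {a..b} (\<lambda>x. f (of_real x + of_real y * \<i>))"
proof -
  have c: "Complex x y = of_real x + of_real y * \<i>" for x by (simp add: complex_eq_iff)
  have l: "linepath (Complex a y) (Complex b y) t = linepath (of_real a) (of_real b) t + of_real y * \<i>" for t
    by (simp add: linepath_def c algebra_simps scaleR_conv_of_real)
  have "contour_integral (linepath (Complex a y) (Complex b y)) f =
    contour_integral (linepath (of_real a) (of_real b)) (\<lambda>z. f (z + of_real y * \<i>))"
    by (simp add: contour_integral_integral l) (simp add: c)
  also have "\<dots> = integral {a..b} (\<lambda>x. f (of_real x + of_real y * \<i>))"
    using assms by (subst contour_integral_linepath_Reals_eq) auto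
  finally show ?thesis .
qed

text \<open>The jump of \<open>1 / (1 - exp (- \<alpha> * z))\<close> between the lines
  \<open>Im z = pi\<close> and \<open>Im z = - pi\<close>, divided by \<open>2 * pi * \<i>\<close>;
  it becomes the density of the mixing measure for \<open>1 < \<alpha> < 2\<close>.\<close>

definition kernel :: "real \<Rightarrow> real \<Rightarrow> real"
  where "kernel \<alpha> x = - sin (pi * \<alpha>) / (pi * (exp (\<alpha> * x) + exp (- (\<alpha> * x)) - 2 * cos (pi * \<alpha>)))"

lemma two_le_exp_plus_exp_minus: "2 \<le> exp x + exp (- x :: real)"
proof -
  have "0 \<le> (exp (x / 2) - exp (- (x / 2)))\<^sup>2" by simp
  also have "\<dots> = exp x + exp (- x) - 2"
    by (simp add: power2_diff flip: exp_double exp_add)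
  finally show ?thesis by simp
qed

lemma sin_neg_abs_cos_less_1:
  assumes "1 < \<alpha>" "\<alpha> < 2"
  shows "sin (pi * \<alpha>) < 0" "\<bar>cos (pi * \<alpha>)\<bar> < 1"
proof -
  show s: "sin (pi * \<alpha>) < 0" using assms by (intro sin_lt_zero) auto
  have "(cos (pi * \<alpha>))\<^sup>2 < 1" using s by (simp add: cos_squared_eq)
  then show "\<bar>cos (pi * \<alpha>)\<bar> < 1" by (simp add: abs_square_less_1)
qed

text \<open>With \<open>e \<ge> 2\<close> for the sum of the two exponentials and
  \<open>c = |cos (pi * \<alpha>)| < 1\<close>, the denominator satisfies
  \<open>e - 2 * cos (pi * \<alpha>) \<ge> (1 - c) * e > 0\<close>.\<close>

lemma kernel_bounds:
  assumes "1 < \<alpha>" "\<alpha> < 2"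
  shows "0 \<le> kernel \<alpha> x"
    and "kernel \<alpha> x \<le> - sin (pi * \<alpha>) / (pi * (1 - \<bar>cos (pi * \<alpha>)\<bar>)) * (1 / (exp (\<alpha> * x) + exp (- (\<alpha> * x))))"
proof -
  define e where "e = exp (\<alpha> * x) + exp (- (\<alpha> * x))"
  define c where "c = \<bar>cos (pi * \<alpha>)\<bar>"
  note sc = sin_neg_abs_cos_less_1[OF assms]
  have e2: "2 \<le> e" unfolding e_def by (rule two_le_exp_plus_exp_minus)
  have c: "0 \<le> c" "c < 1" using sc by (auto simp: c_def)
  have "0 \<le> c * (e - 2)" using c e2 by (intro mult_nonneg_nonneg) auto
  then have "(1 - c) * e \<le> e - 2 * c" by (simp add: algebra_simps)
  also have "\<dots> \<le> e - 2 * cos (pi * \<alpha>)" by (simp add: c_def)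
  finally have le: "(1 - c) * e \<le> e - 2 * cos (pi * \<alpha>)" .
  have c': "0 < 1 - c" and e0: "0 < e" using c e2 by auto
  then have pos: "0 < (1 - c) * e" by (rule mult_pos_pos)
  then show "0 \<le> kernel \<alpha> x"
    unfolding kernel_def e_def[symmetric] using sc le by (intro divide_nonneg_pos mult_pos_pos) auto
  have "kernel \<alpha> x \<le> - sin (pi * \<alpha>) / (pi * ((1 - c) * e))"
    unfolding kernel_def e_def[symmetric] using sc le c' e0 by (intro frac_le mult_pos_pos mult_left_mono) auto
  also have "\<dots> = - sin (pi * \<alpha>) / (pi * (1 - c)) * (1 / e)" by simp
  finally show "kernel \<alpha> x \<le> - sin (pi * \<alpha>) / (pi * (1 - \<bar>cos (pi * \<alpha>)\<bar>)) * (1 / (exp (\<alpha> * x) + exp (- (\<alpha> * x))))"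
    by (simp only: e_def c_def)
qed

text \<open>The majorant \<open>1 / (exp (\<alpha> * x) + exp (- \<alpha> * x))\<close> has the
  bounded antiderivative \<open>arctan (exp (\<alpha> * x)) / \<alpha>\<close>.\<close>

lemma integrable_kernel:
  assumes "1 < \<alpha>" "\<alpha> < 2"
  shows "integrable lborel (kernel \<alpha>)"
proof -
  have pos: "0 < exp (\<alpha> * x) + exp (- (\<alpha> * x))" for x by (intro add_pos_pos) auto
  have "set_integrable lborel (einterval (- \<infinity>) \<infinity>) (\<lambda>x. 1 / (exp (\<alpha> * x) + exp (- (\<alpha> * x))))"
  proof (rule interval_integral_FTC_nonneg(1)[where F = "\<lambda>x. arctan (exp (\<alpha> * x)) / \<alpha>"])
    fix x :: real
    have "((\<lambda>x. arctan (exp (\<alpha> * x)) / \<alpha>) has_real_derivative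
      (inverse (1 + (exp (\<alpha> * x))\<^sup>2) * (exp (\<alpha> * x) * \<alpha>)) / \<alpha>) (at x)"
      using assms by (auto intro!: derivative_eq_intros)
    also have "(inverse (1 + (exp (\<alpha> * x))\<^sup>2) * (exp (\<alpha> * x) * \<alpha>)) / \<alpha> = 1 / (exp (\<alpha> * x) + exp (- (\<alpha> * x)))"
    proof -
      have e: "1 + (exp (\<alpha> * x))\<^sup>2 = exp (\<alpha> * x) * (exp (\<alpha> * x) + exp (- (\<alpha> * x)))"
        by (simp add: power2_eq_square distrib_left flip: exp_add)
      show ?thesis unfolding e using assms by (simp add: inverse_eq_divide)
    qed
    finally show "DERIV (\<lambda>x. arctan (exp (\<alpha> * x)) / \<alpha>) x :> 1 / (exp (\<alpha> * x) + exp (- (\<alpha> * x)))" .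
    show "isCont (\<lambda>x. 1 / (exp (\<alpha> * x) + exp (- (\<alpha> * x)))) x"
      using pos[of x] by (intro continuous_intros) auto
  next
    have "((\<lambda>x. arctan (exp (\<alpha> * x)) / \<alpha>) \<longlongrightarrow> arctan 0 / \<alpha>) at_bot"
    proof (intro tendsto_intros)
      show "((\<lambda>x. exp (\<alpha> * x)) \<longlongrightarrow> 0) at_bot" using assms by real_asymp
    qed (use assms in auto)
    then show "(((\<lambda>x. arctan (exp (\<alpha> * x)) / \<alpha>) \<circ> real_of_ereal) \<longlongrightarrow> arctan 0 / \<alpha>) (at_right (- \<infinity>))"
      by (simp add: ereal_tendsto_simps)
    have "filterlim (\<lambda>x. exp (\<alpha> * x)) at_top at_top" using assms by real_asymp
    then have "((\<lambda>x. arctan (exp (\<alpha> * x)) / \<alpha>) \<longlongrightarrow> (pi / 2) / \<alpha>) at_top"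
      using assms by (intro tendsto_divide filterlim_compose[OF tendsto_arctan_at_top] tendsto_const) auto
    then show "(((\<lambda>x. arctan (exp (\<alpha> * x)) / \<alpha>) \<circ> real_of_ereal) \<longlongrightarrow> (pi / 2) / \<alpha>) (at_left \<infinity>)"
      by (simp add: ereal_tendsto_simps)
  qed (use pos in \<open>auto simp: less_imp_le\<close>)
  then have i: "integrable lborel (\<lambda>x. 1 / (exp (\<alpha> * x) + exp (- (\<alpha> * x))))"
    by (simp add: set_integrable_def)
  show ?thesis
  proof (rule Bochner_Integration.integrable_bound[OF integrable_mult_right[OF i]])
    show "kernel \<alpha> \<in> borel_measurable lborel" unfolding kernel_def by measurable
    show "AE x in lborel. norm (kernel \<alpha> x) \<le>
      norm (- sin (pi * \<alpha>) / (pi * (1 - \<bar>cos (pi * \<alpha>)\<bar>)) * (1 / (exp (\<alpha> * x) + exp (- (\<alpha> * x)))))"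
      using kernel_bounds[OF assms] by (intro AE_I2) (smt (verit) real_norm_def)
  qed
qed

text \<open>The two denominators are conjugates \<open>A\<close> and \<open>cnj A\<close>, so the
  difference of reciprocals is \<open>- 2 * \<i> * Im A / |A|^2\<close>.\<close>

lemma kernel_eq_jump:
  assumes "1 < \<alpha>" "\<alpha> < 2"
  shows "1 / (1 - exp (- (of_real \<alpha> * (of_real x + of_real pi * \<i>)))) - 1 / (1 - exp (- (of_real \<alpha> * (of_real x - of_real pi * \<i>))))
    = 2 * of_real pi * \<i> * of_real (kernel \<alpha> x)"
proof -
  define r where "r = exp (- (\<alpha> * x))"
  define c s where "c = cos (pi * \<alpha>)" and "s = sin (pi * \<alpha>)"
  have r: "0 < r" by (simp add: r_def)
  have ex: "exp (\<alpha> * x) = 1 / r" by (simp add: r_def exp_minus field_simps)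
  have s: "s < 0" unfolding s_def by (rule sin_neg_abs_cos_less_1[OF assms])
  define A where "A = 1 - exp (- (of_real \<alpha> * (of_real x + of_real pi * \<i>)))"
  have A: "A = Complex (1 - r * c) (r * s)"
    by (simp add: A_def r_def c_def s_def complex_eq_iff Re_exp Im_exp mult.commute[of \<alpha>])
  have B: "1 - exp (- (of_real \<alpha> * (of_real x - of_real pi * \<i>))) = cnj A"
    by (simp add: A r_def c_def s_def complex_eq_iff Re_exp Im_exp mult.commute[of \<alpha>])
  have nz: "A \<noteq> 0" using r s by (auto simp: A complex_eq_iff)
  have nA: "(norm A)\<^sup>2 = r * (1 / r + r - 2 * c)"
  proof -
    have "(norm A)\<^sup>2 = 1 - 2 * (r * c) + r\<^sup>2 * (c\<^sup>2 + s\<^sup>2)"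
      unfolding cmod_power2 A by (simp add: power2_eq_square algebra_simps)
    also have "c\<^sup>2 + s\<^sup>2 = 1" by (simp add: c_def s_def)
    finally show ?thesis using r by (simp add: power2_eq_square algebra_simps)
  qed
  have "1 / A - 1 / cnj A = (cnj A - A) / (A * cnj A)" using nz by (simp add: field_simps)
  also have "A * cnj A = of_real ((norm A)\<^sup>2)" by (metis complex_norm_square of_real_power)
  also have "cnj A - A = of_real (- 2 * r * s) * \<i>" by (simp add: A complex_eq_iff)
  also have "of_real (- 2 * r * s) * \<i> / of_real ((norm A)\<^sup>2) = of_real (- 2 * r * s / (norm A)\<^sup>2) * \<i>" by simp
  also have "- 2 * r * s / (norm A)\<^sup>2 = 2 * pi * kernel \<alpha> x"
    unfolding nA kernel_def ex r_def[symmetric] c_def[symmetric] s_def[symmetric] using r by simp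
  finally show ?thesis unfolding A_def[symmetric] B by simp
qed


section \<open>Residues on a rectangle\<close>

lemma norm_one_plus_ge_1:
  assumes "0 \<le> Re z"
  shows "1 \<le> norm (1 + z)"
  using complex_Re_le_cmod[of "1 + z"] assms unfolding plus_complex.simps one_complex.simps by linarith

lemma Re_exp_pos:
  assumes "\<bar>Im z\<bar> < pi / 2"
  shows "0 < Re (exp z)"
proof -
  have "0 < cos (Im z)" using assms by (intro cos_gt_zero_pi) linarith+
  then show ?thesis unfolding Re_exp by (intro mult_pos_pos) auto
qed

lemma exp_eq_1_strip:
  assumes "exp z = 1" "\<bar>Im z\<bar> < 2 * pi"
  shows "z = 0"
proof -
  obtain n :: int where n: "Re z = 0" "Im z = of_int (2 * n) * pi"
    using assms(1) by (auto simp: exp_eq_1)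
  have "\<bar>real_of_int n\<bar> * (2 * pi) < 1 * (2 * pi)" using assms(2) by (simp add: n abs_mult)
  then have "\<bar>real_of_int n\<bar> < 1" by (subst (asm) mult_less_cancel_right_pos) auto
  then have "n = 0" by linarith
  then show ?thesis using n by (simp add: complex_eq_iff)
qed

text \<open>Residue theorem for \<open>1 / ((1 - exp (- \<alpha> * z)) * (1 - exp (w + z)))\<close> on the rectangle with
  corners \<open>\<plusminus> R \<plusminus> \<i> * pi\<close>, whose only poles there are \<open>0\<close> and \<open>- w\<close>; on the horizontal sides
  \<open>exp z = - exp (Re z)\<close>.\<close>

lemma rectangle_integral:
  fixes w :: complex
  assumes \<alpha>: "1 < \<alpha>" "\<alpha> < 2" and w: "Re w < 0" "\<bar>Im w\<bar> < pi / 2" and R: "norm w < R"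
  defines "h \<equiv> \<lambda>z. 1 / ((1 - exp (- (of_real \<alpha> * z))) * (1 - exp (w + z)))"
  shows "contour_integral (linepath (Complex (- R) (- pi)) (Complex R (- pi))) h +
    (contour_integral (linepath (Complex R (- pi)) (Complex R pi)) h +
    (contour_integral (linepath (Complex R pi) (Complex (- R) pi)) h +
     contour_integral (linepath (Complex (- R) pi) (Complex (- R) (- pi))) h)) =
    2 * of_real pi * \<i> * (of_real (1 / \<alpha>) / (1 - exp w) - 1 / (1 - exp (of_real \<alpha> * w)))"
proof -
  \<comment> \<open>Half the width of an open strip around the rectangle. The bound
    \<open>\<alpha> * d \<le> 2 * pi\<close> leaves \<open>0\<close> as the only zero of the first
    factor, and \<open>d + |Im w| < 2 * pi\<close> leaves \<open>- w\<close> as the only zero of the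
    second; \<open>\<alpha> < 2\<close> ensures \<open>d > pi\<close>.\<close>
  define d where "d = min (2 * pi / \<alpha>) (3 * pi / 2)"
  have d: "pi < d" "\<alpha> * d \<le> 2 * pi" "d \<le> 3 * pi / 2"
  proof -
    show "pi < d" using \<alpha> pi_gt_zero by (auto simp: d_def field_simps)
    have "\<alpha> * d \<le> \<alpha> * (2 * pi / \<alpha>)" using \<alpha> by (intro mult_left_mono) (auto simp: d_def)
    then show "\<alpha> * d \<le> 2 * pi" using \<alpha> by simp
  qed (simp add: d_def)
  define S where "S = {z. - d < Im z} \<inter> {z. Im z < d}"
  have S: "open S" "convex S"
    unfolding S_def by (auto intro!: open_Int convex_Int open_halfspace_Im_lt open_halfspace_Im_gt
      convex_halfspace_Im_lt convex_halfspace_Im_gt)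
  have S_iff: "z \<in> S \<longleftrightarrow> \<bar>Im z\<bar> < d" for z by (auto simp: S_def)
  have z1: "1 - exp (- (of_real \<alpha> * z)) \<noteq> 0" if "z \<in> S" "z \<noteq> 0" for z
  proof
    assume "1 - exp (- (of_real \<alpha> * z)) = 0"
    then have "exp (- (of_real \<alpha> * z)) = 1" by simp
    moreover have "\<bar>Im (- (of_real \<alpha> * z))\<bar> < 2 * pi"
    proof -
      have "\<alpha> * \<bar>Im z\<bar> < \<alpha> * d" using that \<alpha> by (intro mult_strict_left_mono) (auto simp: S_iff)
      then have "\<alpha> * \<bar>Im z\<bar> < 2 * pi" using d(2) by linarith
      then show ?thesis using \<alpha> by (simp add: abs_mult)
    qed
    ultimately have "- (of_real \<alpha> * z) = 0" by (rule exp_eq_1_strip)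
    then show False using that \<alpha> by simp
  qed
  have z2: "1 - exp (w + z) \<noteq> 0" if "z \<in> S" "z \<noteq> - w" for z
  proof
    assume "1 - exp (w + z) = 0"
    then have "exp (w + z) = 1" by simp
    moreover have "\<bar>Im (w + z)\<bar> < 2 * pi" using that(1) w d by (simp add: S_iff)
    ultimately have "w + z = 0" by (rule exp_eq_1_strip)
    then show False using that by (simp add: add_eq_0_iff)
  qed
  have w0: "w \<noteq> 0" using w by auto
  have S0: "0 \<in> S" "- w \<in> S" using d w pi_gt_zero unfolding S_iff by auto
  have holo: "h holomorphic_on S - {0, - w}"
    unfolding h_def using z1 z2 by (intro holomorphic_intros) auto
  define a b where "a = Complex (- R) (- pi)" and "b = Complex R pi"
  have box: "z \<in> box a b \<longleftrightarrow> \<bar>Re z\<bar> < R \<and> \<bar>Im z\<bar> < pi" for z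
    by (auto simp: in_box_complex_iff a_def b_def)
  have R0: "0 < R" using R norm_ge_zero[of w] by linarith
  have inbox: "0 \<in> box a b" "- w \<in> box a b"
    using R R0 w pi_gt_zero abs_Re_le_cmod[of w] unfolding box by auto
  have ab: "Re a \<le> Re b" "Im a \<le> Im b" using R0 by (auto simp: a_def b_def)
  have img: "path_image (rectpath a b) \<subseteq> S - {0, - w}"
  proof -
    have "path_image (rectpath a b) \<subseteq> cbox a b" using ab by (rule path_image_rectpath_subset_cbox)
    also have "\<dots> \<subseteq> S" using d by (auto simp: in_cbox_complex_iff a_def b_def S_iff)
    finally show ?thesis using path_image_rectpath_inter_box[OF ab] inbox by blast
  qed
  have res0: "residue h 0 = of_real (1 / \<alpha>) / (1 - exp w)"
  proof -
    let ?B = "ball 0 (min (norm w) d)"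
    have B: "z \<in> S \<and> z \<noteq> - w" if "z \<in> ?B" for z
      using that abs_Im_le_cmod[of z] by (auto simp: S_iff)
    have "residue (\<lambda>z. (1 / (1 - exp (w + z))) / (1 - exp (- (of_real \<alpha> * z)))) 0 =
      (1 / (1 - exp (w + 0))) / (of_real \<alpha>)"
    proof (rule residue_simple_pole_deriv[where s = ?B])
      show "(\<lambda>z. 1 / (1 - exp (w + z))) holomorphic_on ?B"
        using z2 B by (intro holomorphic_intros) auto
      show "((\<lambda>z. 1 - exp (- (of_real \<alpha> * z))) has_field_derivative of_real \<alpha>) (at 0)"
        by (auto intro!: derivative_eq_intros)
      show "0 \<in> ?B" using w0 d pi_gt_zero by simp
    qed (use \<alpha> z2[OF S0(1)] w0 in \<open>auto intro!: holomorphic_intros\<close>)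
    also have "(\<lambda>z. (1 / (1 - exp (w + z))) / (1 - exp (- (of_real \<alpha> * z)))) = h"
      by (simp add: h_def fun_eq_iff)
    finally show ?thesis using \<alpha> by (simp add: field_simps)
  qed
  have res1: "residue h (- w) = - (1 / (1 - exp (of_real \<alpha> * w)))"
  proof -
    let ?B = "ball (- w) (min (norm w) (d - \<bar>Im w\<bar>))"
    have B: "z \<in> S \<and> z \<noteq> 0" if "z \<in> ?B" for z
    proof -
      have "norm (z + w) < min (norm w) (d - \<bar>Im w\<bar>)"
        using that by (simp add: dist_norm norm_minus_commute)
      then show ?thesis using abs_Im_le_cmod[of "z + w"] by (auto simp: S_iff)
    qed
    have "residue (\<lambda>z. (1 / (1 - exp (- (of_real \<alpha> * z)))) / (1 - exp (w + z))) (- w) =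
      (1 / (1 - exp (- (of_real \<alpha> * - w)))) / (- 1)"
    proof (rule residue_simple_pole_deriv[where s = ?B])
      show "(\<lambda>z. 1 / (1 - exp (- (of_real \<alpha> * z)))) holomorphic_on ?B"
        using z1 B by (intro holomorphic_intros) auto
      show "((\<lambda>z. 1 - exp (w + z)) has_field_derivative - 1) (at (- w))"
        by (auto intro!: derivative_eq_intros)
      show "- w \<in> ?B" using w0 d w pi_gt_zero by simp
    qed (use z1[OF S0(2)] w0 in \<open>auto intro!: holomorphic_intros\<close>)
    also have "(\<lambda>z. (1 / (1 - exp (- (of_real \<alpha> * z)))) / (1 - exp (w + z))) = h"
      by (simp add: h_def fun_eq_iff)
    finally show ?thesis by simp
  qed
  have "contour_integral (rectpath a b) h =
    2 * pi * \<i> * (\<Sum>p\<in>{0, - w}. winding_number (rectpath a b) p * residue h p)"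
  proof (rule Residue_theorem[OF S(1) convex_connected[OF S(2)] _ holo _ _ img])
    show "\<forall>z. z \<notin> S \<longrightarrow> winding_number (rectpath a b) z = 0"
      using winding_number_zero_outside[OF _ S(2), of "rectpath a b"] img by auto
  qed auto
  also have "\<dots> = 2 * of_real pi * \<i> * (of_real (1 / \<alpha>) / (1 - exp w) - 1 / (1 - exp (of_real \<alpha> * w)))"
    using w0 by (simp add: winding_number_rectpath inbox res0 res1)
  finally have *: "contour_integral (rectpath a b) h =
    2 * of_real pi * \<i> * (of_real (1 / \<alpha>) / (1 - exp w) - 1 / (1 - exp (of_real \<alpha> * w)))" .
  have ci: "h contour_integrable_on g" if "valid_path g" "path_image g \<subseteq> path_image (rectpath a b)" for g
    by (rule contour_integrable_holomorphic_simple[OF holo _ that(1)]) (use S(1) that(2) img in \<open>auto intro: open_Diff finite_imp_closed\<close>)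
  have rp: "rectpath a b = linepath (Complex (- R) (- pi)) (Complex R (- pi)) +++
     linepath (Complex R (- pi)) (Complex R pi) +++
     linepath (Complex R pi) (Complex (- R) pi) +++ linepath (Complex (- R) pi) (Complex (- R) (- pi))"
    by (simp add: rectpath_def a_def b_def Let_def)
  have sub: "path_image (linepath (Complex (- R) (- pi)) (Complex R (- pi))) \<subseteq> path_image (rectpath a b)"
    "path_image (linepath (Complex R (- pi)) (Complex R pi)) \<subseteq> path_image (rectpath a b)"
    "path_image (linepath (Complex R pi) (Complex (- R) pi)) \<subseteq> path_image (rectpath a b)"
    "path_image (linepath (Complex (- R) pi) (Complex (- R) (- pi))) \<subseteq> path_image (rectpath a b)"
    unfolding rp by (auto simp: path_image_join)
  have "contour_integral (rectpath a b) h =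
    contour_integral (linepath (Complex (- R) (- pi)) (Complex R (- pi))) h +
    (contour_integral (linepath (Complex R (- pi)) (Complex R pi)) h +
    (contour_integral (linepath (Complex R pi) (Complex (- R) pi)) h +
     contour_integral (linepath (Complex (- R) pi) (Complex (- R) (- pi))) h))"
    unfolding rp using sub[THEN ci[OF valid_path_linepath]] by simp
  then show ?thesis using * by simp
qed


lemma norm_one_minus_exp_ge: "\<bar>1 - exp (Re z)\<bar> \<le> norm (1 - exp z)"
  using norm_triangle_ineq3[of 1 "exp z"] by simp

text \<open>Let \<open>R\<close> tend to infinity in \<open>rectangle_integral\<close>: the vertical
  sides vanish, and the horizontal sides combine to the integral of the jump.\<close>

lemma kernel_identity:
  fixes w :: complex
  assumes \<alpha>: "1 < \<alpha>" "\<alpha> < 2" and w: "Re w < 0" "\<bar>Im w\<bar> < pi / 2"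
  shows "1 / (1 - exp (of_real \<alpha> * w)) = of_real (1 / \<alpha>) / (1 - exp w) +
    (\<integral>x. kernel \<alpha> x *\<^sub>R (1 / (1 + exp (w + of_real x))) \<partial>lborel)"
proof -
  define h where "h z = 1 / ((1 - exp (- (of_real \<alpha> * z))) * (1 - exp (w + z)))" for z
  define K where "K x = kernel \<alpha> x *\<^sub>R (1 / (1 + exp (w + of_real x)))" for x
  have ge1: "1 \<le> norm (1 + exp (w + of_real x))" for x
    using Re_exp_pos[of "w + of_real x"] w by (intro norm_one_plus_ge_1) (auto intro: less_imp_le)
  have nz: "1 + exp (w + of_real x) \<noteq> 0" for x using ge1[of x] by force
  have K_meas [measurable]: "K \<in> borel_measurable lborel"
    unfolding K_def kernel_def by measurable
  have K_le: "norm (K x) \<le> kernel \<alpha> x" for x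
  proof -
    have "norm (1 / (1 + exp (w + of_real x))) \<le> 1" using ge1[of x] by (simp add: norm_divide divide_le_eq)
    then show ?thesis unfolding K_def norm_scaleR using kernel_bounds(1)[OF \<alpha>, of x] by (simp add: mult_left_le)
  qed
  have K_int: "integrable lborel K"
    by (rule Bochner_Integration.integrable_bound[OF integrable_kernel[OF \<alpha>] K_meas])
      (use K_le kernel_bounds(1)[OF \<alpha>] in \<open>auto intro!: AE_I2\<close>)
  have K_cont: "continuous_on A K" for A
  proof -
    have "exp (\<alpha> * x) + exp (- (\<alpha> * x)) - 2 * cos (pi * \<alpha>) \<noteq> 0" for x
      using two_le_exp_plus_exp_minus[of "\<alpha> * x"] sin_neg_abs_cos_less_1[OF \<alpha>] by linarith
    then show ?thesis unfolding K_def kernel_def using nz by (intro continuous_intros) auto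
  qed
  \<comment> \<open>A shift by \<open>pi * \<i>\<close> in either direction negates the exponential,
    so the second factor agrees on both lines and only the first one jumps.\<close>
  have jump: "h (of_real x + of_real (- pi) * \<i>) - h (of_real x + of_real pi * \<i>) = - (2 * of_real pi * \<i>) * K x" for x
  proof -
    define A B where "A = 1 - exp (- (of_real \<alpha> * (of_real x + of_real pi * \<i>)))"
      and "B = 1 - exp (- (of_real \<alpha> * (of_real x - of_real pi * \<i>)))"
    define D where "D = 1 + exp (w + of_real x)"
    have e: "1 - exp (w + (of_real x + of_real pi * \<i>)) = D" "1 - exp (w + (of_real x + of_real (- pi) * \<i>)) = D"
      by (simp_all add: D_def exp_add exp_diff exp_minus flip: add.assoc)
    have "h (of_real x + of_real (- pi) * \<i>) - h (of_real x + of_real pi * \<i>) = - ((1 / A - 1 / B) / D)"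
      unfolding h_def e by (simp add: A_def B_def diff_divide_distrib)
    also have "1 / A - 1 / B = 2 * of_real pi * \<i> * of_real (kernel \<alpha> x)"
      unfolding A_def B_def by (rule kernel_eq_jump[OF \<alpha>])
    finally show ?thesis by (simp add: K_def D_def scaleR_conv_of_real)
  qed
  define V where "V = of_real (1 / \<alpha>) / (1 - exp w) - 1 / (1 - exp (of_real \<alpha> * w))"
  define r where "r R = contour_integral (linepath (Complex R (- pi)) (Complex R pi)) h" for R
  define l where "l R = contour_integral (linepath (Complex (- R) pi) (Complex (- R) (- pi))) h" for R
  \<comment> \<open>The maximum of \<open>norm h\<close> on a vertical side times its length
    \<open>2 * pi\<close>. The second factor forces decay as \<open>x\<close> tends to infinity, the
    first as \<open>x\<close> tends to minus infinity.\<close>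
  define bnd where "bnd x = 1 / (\<bar>1 - exp (- (\<alpha> * x))\<bar> * \<bar>1 - exp (Re w + x)\<bar>) * (2 * pi)" for x
  have h_bound: "norm (h z) \<le> 1 / (\<bar>1 - exp (- (\<alpha> * Re z))\<bar> * \<bar>1 - exp (Re w + Re z)\<bar>)"
    if "Re z \<noteq> 0" "Re w + Re z \<noteq> 0" for z
    unfolding h_def norm_divide norm_mult norm_one
    using that \<alpha> norm_one_minus_exp_ge[of "- (of_real \<alpha> * z)"] norm_one_minus_exp_ge[of "w + z"]
    by (intro divide_left_mono mult_mono mult_pos_pos) (auto simp: not_le)
  have side: "norm (contour_integral (linepath (Complex x y) (Complex x y')) h) \<le> bnd x"
    if "\<bar>y - y'\<bar> = 2 * pi" "x \<noteq> 0" "Re w + x \<noteq> 0" for x y y'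
  proof -
    define B where "B = 1 / (\<bar>1 - exp (- (\<alpha> * x))\<bar> * \<bar>1 - exp (Re w + x)\<bar>)"
    have hb: "norm (h z) \<le> B" if "z \<in> closed_segment (Complex x y) (Complex x y')" for z
    proof -
      have "Re z = x" using that by (auto simp: closed_segment_same_Re)
      then show ?thesis using h_bound[of z] \<open>x \<noteq> 0\<close> \<open>Re w + x \<noteq> 0\<close> by (simp add: B_def)
    qed
    have nzs: "1 - exp (- (of_real \<alpha> * z)) \<noteq> 0" "1 - exp (w + z) \<noteq> 0"
      if "z \<in> closed_segment (Complex x y) (Complex x y')" for z
    proof -
      have "Re z = x" using that by (auto simp: closed_segment_same_Re)
      then show "1 - exp (- (of_real \<alpha> * z)) \<noteq> 0" "1 - exp (w + z) \<noteq> 0"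
        using norm_one_minus_exp_ge[of "- (of_real \<alpha> * z)"] norm_one_minus_exp_ge[of "w + z"]
          \<open>x \<noteq> 0\<close> \<open>Re w + x \<noteq> 0\<close> \<alpha> by auto
    qed
    have "norm (contour_integral (linepath (Complex x y) (Complex x y')) h) \<le> B * norm (Complex x y' - Complex x y)"
    proof (rule contour_integral_bound_linepath)
      show "h contour_integrable_on linepath (Complex x y) (Complex x y')"
        unfolding h_def using nzs
        by (intro contour_integrable_continuous_linepath continuous_intros) auto
    qed (use hb in \<open>auto simp: B_def\<close>)
    also have "Complex x y' - Complex x y = of_real (y' - y) * \<i>" by (simp add: complex_eq_iff)
    also have "norm (of_real (y' - y) * \<i>) = 2 * pi" using that
    by (simp only: norm_mult norm_of_real norm_ii abs_minus_commute[of y'] mult_1_right)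
    finally show ?thesis by (simp add: bnd_def B_def)
  qed
  have bnd: "(bnd \<longlongrightarrow> 0) at_top" "((\<lambda>R. bnd (- R)) \<longlongrightarrow> 0) at_top"
    unfolding bnd_def using \<alpha> by real_asymp+
  have ev: "\<forall>\<^sub>F R in at_top. norm w < R" by (rule eventually_gt_at_top)
  have side_neq: "R \<noteq> 0" "Re w + R \<noteq> 0" "- R \<noteq> 0" "Re w + - R \<noteq> 0" if "norm w < R" for R
    using that abs_Re_le_cmod[of w] w by auto
  have r0: "(r \<longlongrightarrow> 0) at_top"
    by (rule Lim_null_comparison[OF eventually_mono[OF ev] bnd(1)])
      (unfold r_def, rule side, use side_neq pi_gt_zero in auto)
  have l0: "(l \<longlongrightarrow> 0) at_top"
    by (rule Lim_null_comparison[OF eventually_mono[OF ev] bnd(2)])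
      (unfold l_def, rule side, use side_neq pi_gt_zero in auto)
  have eq: "- (2 * of_real pi * \<i>) * (LINT x:{-R..R}|lborel. K x) + r R + l R = 2 * of_real pi * \<i> * V"
    if R: "norm w < R" for R
  proof -
    have R0: "- R < R" using R norm_ge_zero[of w] by linarith
    define H where "H y x = h (of_real x + of_real y * \<i>)" for y x
    have H_cont: "H y integrable_on {- R..R}" if "\<bar>y\<bar> = pi" for y
    proof (rule integrable_continuous_real)
      have "1 - exp (- (of_real \<alpha> * (of_real x + of_real y * \<i>))) \<noteq> 0" for x
      proof
        assume "1 - exp (- (of_real \<alpha> * (of_real x + of_real y * \<i>))) = 0"
        then have "exp (- (of_real \<alpha> * (of_real x + of_real y * \<i>))) = 1" by simp
        moreover have "\<bar>Im (- (of_real \<alpha> * (of_real x + of_real y * \<i>)))\<bar> < 2 * pi"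
          using that \<alpha> by (simp add: abs_mult)
        ultimately have "- (of_real \<alpha> * (of_real x + of_real y * \<i>)) = 0" by (rule exp_eq_1_strip)
        then show False using that \<alpha> pi_gt_zero by (auto simp: complex_eq_iff)
      qed
      moreover have "1 - exp (w + (of_real x + of_real y * \<i>)) \<noteq> 0" for x
      proof -
        have "y = pi \<or> y = - pi" using that by linarith
        then have "exp (w + (of_real x + of_real y * \<i>)) = - exp (w + of_real x)"
          by (auto simp: exp_add exp_diff exp_minus simp flip: add.assoc)
        then show ?thesis using nz[of x] by simp
      qed
      ultimately show "continuous_on {- R..R} (H y)"
        unfolding H_def h_def by (intro continuous_intros) auto
    qed
    have top: "contour_integral (linepath (Complex R pi) (Complex (- R) pi)) h = - integral {- R..R} (H pi)"
      using contour_integral_linepath_horizontal[OF R0, of pi h]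
        contour_integral_reversepath[of "linepath (Complex (- R) pi) (Complex R pi)" h]
      by (simp add: H_def[abs_def])
    have "integral {- R..R} (H (- pi)) - integral {- R..R} (H pi) = integral {- R..R} (\<lambda>x. H (- pi) x - H pi x)"
      by (rule integral_diff[symmetric]) (use H_cont pi_gt_zero in auto)
    also have "\<dots> = integral {- R..R} (\<lambda>x. - (2 * of_real pi * \<i>) * K x)"
      by (simp only: H_def jump)
    also have "\<dots> = - (2 * of_real pi * \<i>) * integral {- R..R} K"
      by (rule integral_mult_right)
    also have "integral {- R..R} K = (LINT x:{-R..R}|lborel. K x)"
      by (rule set_borel_integral_eq_integral(2)[symmetric])
        (use K_int in \<open>auto simp: set_integrable_def intro!: integrable_mult_indicator\<close>)
    finally have hor: "integral {- R..R} (H (- pi)) - integral {- R..R} (H pi) = - (2 * of_real pi * \<i>) * (LINT x:{-R..R}|lborel. K x)" .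
    have "integral {- R..R} (H (- pi)) + (r R + (- integral {- R..R} (H pi) + l R)) = 2 * of_real pi * \<i> * V"
      using rectangle_integral[OF \<alpha> w R] contour_integral_linepath_horizontal[OF R0, of "- pi" h] top
      unfolding h_def[abs_def, symmetric] V_def r_def l_def H_def[abs_def] by simp
    then show ?thesis unfolding hor[symmetric] by (simp add: algebra_simps)
  qed
  have lim: "((\<lambda>R. LINT x:{-R..R}|lborel. K x) \<longlongrightarrow> (\<integral>x. K x \<partial>lborel)) at_top"
    unfolding set_lebesgue_integral_def
  proof (rule integral_dominated_convergence_at_top[OF _ _ integrable_norm[OF K_int]])
    show "AE x in lborel. ((\<lambda>R. indicator {- R..R} x *\<^sub>R K x) \<longlongrightarrow> K x) at_top"
    proof (intro AE_I2 tendsto_eventually)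
      fix x :: real
      show "\<forall>\<^sub>F R in at_top. indicator {- R..R} x *\<^sub>R K x = K x"
        using eventually_ge_at_top[of "\<bar>x\<bar>"] by eventually_elim (auto simp: indicator_def)
    qed
    show "\<forall>\<^sub>F R in at_top. AE x in lborel. norm (indicator {- R..R} x *\<^sub>R K x) \<le> norm (K x)"
      by (intro always_eventually allI AE_I2) (auto simp: indicator_def)
  qed measurable
  have "((\<lambda>R. - (2 * of_real pi * \<i>) * (LINT x:{-R..R}|lborel. K x) + r R + l R) \<longlongrightarrow>
      - (2 * of_real pi * \<i>) * (\<integral>x. K x \<partial>lborel) + 0 + 0) at_top"
    by (intro tendsto_intros lim r0 l0)
  moreover have "\<forall>\<^sub>F R in at_top. - (2 * of_real pi * \<i>) * (LINT x:{-R..R}|lborel. K x) + r R + l R = 2 * of_real pi * \<i> * V"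
    using ev by eventually_elim (rule eq)
  ultimately have "((\<lambda>R::real. 2 * of_real pi * \<i> * V) \<longlongrightarrow> - (2 * of_real pi * \<i>) * (\<integral>x. K x \<partial>lborel) + 0 + 0) at_top"
    by (rule Lim_transform_eventually)
  then have "2 * of_real pi * \<i> * V = - (2 * of_real pi * \<i>) * (\<integral>x. K x \<partial>lborel) + 0 + 0"
    by (simp only: tendsto_const_iff[OF trivial_limit_at_top_linorder])
  then have "2 * of_real pi * \<i> * (V + (\<integral>x. K x \<partial>lborel)) = 0"
    by (simp only: distrib_left) simp
  then have "V + (\<integral>x. K x \<partial>lborel) = 0" using pi_gt_zero by simp
  then show ?thesis by (simp add: V_def K_def algebra_simps)
qed

section \<open>The backward difference scheme\<close>

text \<open>The coefficient of \<open>s ^ n\<close> in \<open>(1 - s) powr (\<alpha> - \<beta>) /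
  ((1 - s) powr \<alpha> - l)\<close>. Unlike in \<open>ml_poly\<close>, the powers of
  \<open>l\<close> carry no powers of \<open>s\<close>, so the sum over \<open>k\<close> is
  infinite; it is used for \<open>norm l < 1\<close>.\<close>

definition ml_series :: "real \<Rightarrow> real \<Rightarrow> nat \<Rightarrow> 'a \<Rightarrow> 'a::{real_normed_field,banach}"
  where "ml_series \<alpha> \<beta> n l = (\<Sum>k. of_real (rising (\<alpha> * real k + \<beta>) n) * l ^ k)"

lemma ml_series_limit:
  fixes z :: "'a::{real_normed_field,banach}"
  assumes "0 < \<alpha>" "1 \<le> \<beta>"
  shows "(\<lambda>n. of_real (real n powr (1 - \<beta>)) * ml_series \<alpha> \<beta> n (z / of_real (real n powr \<alpha>)))
    \<longlonglongrightarrow> mittag_leffler \<alpha> \<beta> z"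
proof -
  have "(\<lambda>n. of_real (real n powr (1 - \<beta>)) * (\<Sum>k. of_real (1 * rising (\<alpha> * real k + \<beta>) n) *
    (z / of_real (real n powr \<alpha>)) ^ k)) \<longlonglongrightarrow> mittag_leffler \<alpha> \<beta> z"
    by (rule mittag_leffler_limit[where l = "\<lambda>_. 0"]) (use assms in auto)
  then show ?thesis by (simp only: ml_series_def mult_1)
qed

lemma summable_ml_series:
  fixes l :: "'a::{real_normed_field,banach}"
  assumes "0 < \<alpha>" "0 \<le> \<beta>" "norm l < 1"
  shows "summable (\<lambda>k. of_real (rising (\<alpha> * real k + \<beta>) n) * l ^ k)"
proof (rule summable_norm_cancel)
  have "summable (\<lambda>k. rising (\<alpha> * real k + \<beta>) n * norm l ^ k)"
    using assms by (intro summable_rising_powser) auto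
  moreover have "norm (of_real (rising (\<alpha> * real k + \<beta>) n) * l ^ k) = rising (\<alpha> * real k + \<beta>) n * norm l ^ k" for k
    using assms by (simp add: norm_mult norm_power rising_nonneg)
  ultimately show "summable (\<lambda>k. norm (of_real (rising (\<alpha> * real k + \<beta>) n) * l ^ k))" by simp
qed

lemma ml_series_of_real:
  assumes "0 < \<alpha>" "0 \<le> \<beta>" "\<bar>x\<bar> < 1"
  shows "ml_series \<alpha> \<beta> n (of_real x :: complex) = of_real (ml_series \<alpha> \<beta> n x)"
proof -
  have "summable (\<lambda>k. rising (\<alpha> * real k + \<beta>) n * x ^ k)"
    using summable_ml_series[OF assms(1,2), of x] assms(3) by simp
  then show ?thesis by (simp add: ml_series_def suminf_of_real)
qed

text \<open>Reduces \<open>\<beta> \<ge> 1\<close> to \<open>\<beta> = 1\<close>: for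
  \<open>\<gamma> = \<beta> - 1\<close> the weights \<open>rising \<gamma> j\<close> are
  nonnegative.\<close>

lemma ml_series_add:
  fixes l :: "'a::{real_normed_field,banach}"
  assumes "0 < \<alpha>" "0 \<le> \<beta>" "norm l < 1"
  shows "ml_series \<alpha> (\<gamma> + \<beta>) n l = (\<Sum>j\<le>n. of_real (rising \<gamma> j) * ml_series \<alpha> \<beta> (n - j) l)"
proof -
  have "of_real (rising (\<alpha> * real k + (\<gamma> + \<beta>)) n) * l ^ k =
    (\<Sum>j\<le>n. of_real (rising \<gamma> j) * (of_real (rising (\<alpha> * real k + \<beta>) (n - j)) * l ^ k))" for k
    by (simp only: add.left_commute[of _ \<gamma>] rising_add of_real_sum sum_distrib_right of_real_mult mult.assoc)
  then have "ml_series \<alpha> (\<gamma> + \<beta>) n l =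
    (\<Sum>k. \<Sum>j\<le>n. of_real (rising \<gamma> j) * (of_real (rising (\<alpha> * real k + \<beta>) (n - j)) * l ^ k))"
    by (simp only: ml_series_def)
  also have "\<dots> = (\<Sum>j\<le>n. \<Sum>k. of_real (rising \<gamma> j) * (of_real (rising (\<alpha> * real k + \<beta>) (n - j)) * l ^ k))"
    by (intro suminf_sum summable_mult summable_ml_series assms)
  also have "\<dots> = (\<Sum>j\<le>n. of_real (rising \<gamma> j) * ml_series \<alpha> \<beta> (n - j) l)"
    unfolding ml_series_def by (intro sum.cong refl suminf_mult summable_ml_series assms)
  finally show ?thesis .
qed

text \<open>A double series summed in both orders: over \<open>n\<close> first it is a binomial
  series and then geometric in \<open>k\<close>; over \<open>k\<close> first it gives
  \<open>ml_series\<close>. Working with \<open>w\<close> and \<open>Ln (1 - s)\<close> makes the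
  \<open>\<alpha>\<close>-th powers single-valued.\<close>

lemma ml_series_generating_function:
  fixes w s :: complex
  assumes \<alpha>: "0 < \<alpha>" and s: "exp (Re w) < 1 - norm s"
  shows "(\<lambda>n. ml_series \<alpha> 1 n (exp (of_real \<alpha> * w)) * s ^ n) sums
    (1 / ((1 - s) * (1 - exp (of_real \<alpha> * (w - Ln (1 - s))))))"
proof -
  define l where "l = exp (of_real \<alpha> * w)"
  define f where "f k n = of_real (rising (\<alpha> * real k + 1) n) * s ^ n * l ^ k" for k n
  have s1: "norm s < 1" using s by (smt (verit) exp_gt_zero)
  have s0: "1 - s \<noteq> 0" using s1 by auto
  have nl: "norm l = exp (Re w) powr \<alpha>" by (simp add: l_def powr_def)
  have "exp (Re w) < 1" using s norm_ge_zero[of s] by linarith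
  then have l1: "norm l < 1" using \<alpha> by (simp add: l_def mult_pos_neg)
  \<comment> \<open>The sums over \<open>n\<close> of the norms are geometric in \<open>k\<close>
    with ratio \<open>q\<close>; the hypothesis on \<open>s\<close> is what makes
    \<open>q < 1\<close>.\<close>
  define q where "q = (1 - norm s) powr (- \<alpha>) * norm l"
  have q: "0 \<le> q" "q < 1"
  proof -
    have "exp (Re w) powr \<alpha> < (1 - norm s) powr \<alpha>"
      using s \<alpha> by (intro powr_less_mono2) auto
    then show "q < 1" using s1 by (simp add: q_def nl powr_minus field_simps)
  qed (simp add: q_def)
  have nf: "norm (f k n) = rising (\<alpha> * real k + 1) n * norm s ^ n * norm l ^ k" for k n
    using \<alpha> by (simp add: f_def norm_mult norm_power rising_nonneg)
  have inner_norm: "((\<lambda>n. norm (f k n)) has_sum (1 - norm s) powr (- 1) * q ^ k) UNIV" for k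
  proof (rule sums_nonneg_imp_has_sum)
    have "(\<lambda>n. rising (\<alpha> * real k + 1) n * norm s ^ n) sums (1 - norm s) powr (- (\<alpha> * real k + 1))"
      using s1 by (intro rising_sums_real) auto
    from sums_mult2[OF this, of "norm l ^ k"]
    have "(\<lambda>n. norm (f k n)) sums ((1 - norm s) powr (- (\<alpha> * real k + 1)) * norm l ^ k)"
      by (simp only: nf)
    also have "(1 - norm s) powr (- (\<alpha> * real k + 1)) = (1 - norm s) powr (- 1) * ((1 - norm s) powr (- \<alpha>)) powr real k"
      by (simp only: powr_powr powr_add[symmetric]) (simp add: algebra_simps)
    also have "((1 - norm s) powr (- \<alpha>)) powr real k = ((1 - norm s) powr (- \<alpha>)) ^ k"
      using s1 by (intro powr_realpow) auto
    finally show "(\<lambda>n. norm (f k n)) sums ((1 - norm s) powr (- 1) * q ^ k)"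
      by (simp add: q_def power_mult_distrib mult_ac)
  qed auto
  have "(\<lambda>p. norm ((\<lambda>(k, n). f k n) p)) summable_on UNIV \<times> UNIV"
  proof (subst Infinite_Sum.abs_summable_on_Sigma_iff, intro conjI ballI)
    show "(\<lambda>n. norm (case (k, n) of (k, n) \<Rightarrow> f k n)) summable_on UNIV" for k
      using inner_norm[of k] by (auto simp: summable_on_def)
    have "summable (\<lambda>k. norm ((1 - norm s) powr (- 1) * q ^ k))"
      using q by (simp add: norm_mult norm_power abs_mult summable_mult summable_geometric)
    then have "(\<lambda>k. norm ((1 - norm s) powr (- 1) * q ^ k)) summable_on UNIV"
      by (intro norm_summable_imp_summable_on) simp
    moreover have "infsum (\<lambda>n. norm (case (k, n) of (k, n) \<Rightarrow> f k n)) UNIV = (1 - norm s) powr (- 1) * q ^ k" for k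
      using infsumI[OF inner_norm[of k]] by simp
    ultimately show "(\<lambda>k. norm (\<Sum>\<^sub>\<infinity>n. norm (case (k, n) of (k, n) \<Rightarrow> f k n))) summable_on UNIV"
      by simp
  qed
  then have summ: "(\<lambda>(k, n). f k n) summable_on UNIV \<times> UNIV"
    by (rule abs_summable_summable)
  have row: "infsum (f k) UNIV = (1 / (1 - s)) * exp (of_real \<alpha> * (w - Ln (1 - s))) ^ k" for k
  proof -
    have "(\<lambda>n. of_real (rising (\<alpha> * real k + 1) n) * s ^ n) sums (1 - s) powr (of_real (- (\<alpha> * real k + 1)))"
      using s1 by (rule rising_sums)
    from sums_mult2[OF this, of "l ^ k"]
    have S: "f k sums ((1 - s) powr (of_real (- (\<alpha> * real k + 1))) * l ^ k)"
      by (simp only: f_def[abs_def])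
    have "(1 - s) powr (of_real (- (\<alpha> * real k + 1))) * l ^ k =
      exp (- Ln (1 - s)) * exp (of_nat k * (of_real \<alpha> * (w - Ln (1 - s))))"
      using s1 by (auto simp: powr_def l_def algebra_simps simp flip: exp_add exp_of_nat_mult)
    also have "\<dots> = (1 / (1 - s)) * exp (of_real \<alpha> * (w - Ln (1 - s))) ^ k"
    proof -
      have "exp (- Ln (1 - s)) = 1 / (1 - s)"
        using exp_Ln[OF s0] by (simp only: exp_minus inverse_eq_divide)
      then show ?thesis by (simp only: exp_of_nat_mult)
    qed
    finally have "f k sums ((1 / (1 - s)) * exp (of_real \<alpha> * (w - Ln (1 - s))) ^ k)"
      using S by simp
    moreover have "summable (\<lambda>n. norm (f k n))"
      using has_sum_imp_sums[OF inner_norm[of k]] by (rule sums_summable)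
    ultimately show ?thesis by (intro infsumI norm_summable_imp_has_sum)
  qed
  have col: "infsum (\<lambda>k. f k n) UNIV = ml_series \<alpha> 1 n l * s ^ n" for n
  proof -
    have "(\<lambda>k. of_real (rising (\<alpha> * real k + 1) n) * l ^ k) sums ml_series \<alpha> 1 n l"
      unfolding ml_series_def using \<alpha> l1 by (intro summable_sums summable_ml_series) auto
    from sums_mult2[OF this, of "s ^ n"] have "(\<lambda>k. f k n) sums (ml_series \<alpha> 1 n l * s ^ n)"
      by (simp add: f_def[abs_def] mult_ac)
    moreover have "summable (\<lambda>k. norm (f k n))"
    proof -
      have "summable (\<lambda>k. rising (\<alpha> * real k + 1) n * norm l ^ k * norm s ^ n)"
        using \<alpha> l1 by (intro summable_mult2 summable_rising_powser) auto
      then show ?thesis by (simp add: nf mult_ac)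
    qed
    ultimately show ?thesis by (intro infsumI norm_summable_imp_has_sum)
  qed
  define r where "r = exp (of_real \<alpha> * (w - Ln (1 - s)))"
  have r1: "norm r < 1"
  proof -
    have "exp (Re w) < norm (1 - s)" using s norm_triangle_ineq2[of 1 s] by simp
    then have "Re w < ln (norm (1 - s))" using ln_less_cancel_iff[of "exp (Re w)" "norm (1 - s)"] s0 by simp
    then have "\<alpha> * (Re w - ln (norm (1 - s))) < 0" using \<alpha> by (simp add: mult_less_0_iff)
    then show ?thesis using s0 by (simp add: r_def)
  qed
  have "(\<Sum>\<^sub>\<infinity>n. ml_series \<alpha> 1 n l * s ^ n) = (\<Sum>\<^sub>\<infinity>k. (1 / (1 - s)) * r ^ k)"
    using infsum_swap_banach[OF summ] unfolding row col r_def[symmetric] by simp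
  also have "\<dots> = (1 / (1 - s)) * (1 / (1 - r))"
  proof (rule infsumI, rule norm_summable_imp_has_sum)
    show "summable (\<lambda>k. norm (1 / (1 - s) * r ^ k))"
      unfolding norm_mult norm_power using r1 by (intro summable_mult summable_geometric) auto
    show "(\<lambda>k. 1 / (1 - s) * r ^ k) sums (1 / (1 - s) * (1 / (1 - r)))"
      using r1 by (intro sums_mult geometric_sums)
  qed
  finally have val: "(\<Sum>\<^sub>\<infinity>n. ml_series \<alpha> 1 n l * s ^ n) = (1 / (1 - s)) * (1 / (1 - r))" .
  have "(\<lambda>n. \<Sum>\<^sub>\<infinity>k. f k n) summable_on UNIV"
  proof (rule summable_on_Sigma_banach)
    show "(\<lambda>(n, k). f k n) summable_on (UNIV \<times> UNIV)"
      using summ by (subst (asm) summable_on_swap) simp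
  qed
  then have "((\<lambda>n. ml_series \<alpha> 1 n l * s ^ n) has_sum (1 / (1 - s)) * (1 / (1 - r))) UNIV"
    unfolding col val[symmetric] by (rule has_sum_infsum)
  from has_sum_imp_sums[OF this] show ?thesis unfolding l_def r_def by simp
qed

section \<open>Mixture representation and coefficient comparison\<close>

lemma powser_coeff_eq:
  fixes a b :: "nat \<Rightarrow> complex"
  assumes "0 < r"
    and "\<And>s. norm s < r \<Longrightarrow> (\<lambda>n. a n * s ^ n) sums f s"
    and "\<And>s. norm s < r \<Longrightarrow> (\<lambda>n. b n * s ^ n) sums f s"
  shows "a n = b n"
proof (rule ccontr)
  assume "a n \<noteq> b n"
  define d where "d n = a n - b n" for n
  have d: "(\<lambda>n. d n * (s - 0) ^ n) sums 0" if "norm (s - 0) < r" for s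
    using sums_diff[OF assms(2,3)[of s]] that by (simp add: d_def left_diff_distrib)
  \<comment> \<open>The isolated-zero theorem below is applied to a nonzero coefficient at a
    positive index, so index 0 is settled separately.\<close>
  have "d 0 = 0" using d[of 0] \<open>0 < r\<close> by simp
  then have n: "0 < n" using \<open>a n \<noteq> b n\<close> by (cases n) (auto simp: d_def)
  have dn: "d n \<noteq> 0" using \<open>a n \<noteq> b n\<close> by (simp add: d_def)
  show False
  proof (rule powser_0_nonzero[of r 0 d "\<lambda>_. 0" n])
    fix t :: real assume t: "0 < t" "\<And>z::complex. z \<in> cball 0 t - {0} \<Longrightarrow> (0::complex) \<noteq> 0"
    then show False using t(2)[of "of_real t"] by simp
  qed (use \<open>0 < r\<close> d dn n in auto)
qed

text \<open>\<^prop>\<open>resolvent_mixture \<alpha> c M\<close> says that \<open>t \<mapsto> E\<^bsub>\<alpha>,1\<^esub> (t powr \<alpha>)\<close> is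
  \<open>c * exp t + (\<integral>x. exp (- t * exp x) \<partial>M)\<close>, expressed through its Laplace transform.\<close>

definition resolvent_mixture :: "real \<Rightarrow> real \<Rightarrow> real measure \<Rightarrow> bool"
  where "resolvent_mixture \<alpha> c M \<longleftrightarrow> 0 < \<alpha> \<and> 0 \<le> c \<and> finite_measure M \<and> sets M = sets borel \<and>
    (\<forall>w. Re w < 0 \<longrightarrow> \<bar>Im w\<bar> < pi / 2 \<longrightarrow>
      1 / (1 - exp (of_real \<alpha> * w)) = of_real c / (1 - exp w) + (\<integral>x. 1 / (1 + exp (w + of_real x)) \<partial>M))"

text \<open>Replacing \<open>w\<close> by \<open>w - Ln (1 - s)\<close> divides \<open>exp w\<close>
  by \<open>1 - s\<close>. The representation there, divided by \<open>1 - s\<close>, has the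
  generating function on the left and geometric series in \<open>s\<close> on the right; the
  coefficients of \<open>s ^ n\<close> agree.\<close>

lemma ml_series_eq_integral:
  fixes M :: "real measure" and w :: complex
  assumes rm: "resolvent_mixture \<alpha> c M"
    and w: "Re w < 0" "\<bar>Im w\<bar> < pi / 2"
  shows "ml_series \<alpha> 1 n (exp (of_real \<alpha> * w)) =
    of_real c / (1 - exp w) ^ Suc n + (\<integral>x. 1 / (1 + exp (w + of_real x)) ^ Suc n \<partial>M)"
proof -
  have \<alpha>: "0 < \<alpha>" and c: "0 \<le> c" and M: "sets M = sets borel" and fm: "finite_measure M"
    using rm by (auto simp: resolvent_mixture_def)
  interpret finite_measure M by (rule fm)
  note M[measurable_cong]
  have rep: "\<forall>w. Re w < 0 \<longrightarrow> \<bar>Im w\<bar> < pi / 2 \<longrightarrow>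
      1 / (1 - exp (of_real \<alpha> * w)) = of_real c / (1 - exp w) + (\<integral>x. 1 / (1 + exp (w + of_real x)) \<partial>M)"
    using rm by (simp add: resolvent_mixture_def)
  \<comment> \<open>\<open>|Im w| < pi / 2\<close> puts \<open>exp (w + x)\<close> in the right
    half-plane. The integrands are then bounded by 1, hence integrable for the finite measure
    \<open>M\<close>.\<close>
  have ge1: "1 \<le> norm (1 + exp (w + of_real x))" for x
    using Re_exp_pos[of "w + of_real x"] w by (intro norm_one_plus_ge_1) (auto intro: less_imp_le)
  have nz: "1 + exp (w + of_real x) \<noteq> 0" for x using ge1[of x] by force
  have le1: "norm (1 / (1 + exp (w + of_real x)) ^ m) \<le> 1" for x m
    using one_le_power[OF ge1[of x], of m] by (simp add: norm_divide norm_power divide_le_eq)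
  have ew: "norm (exp w) < 1" using w by simp
  define I where "I m = (\<integral>x. 1 / (1 + exp (w + of_real x)) ^ Suc m \<partial>M)" for m
  have int: "integrable M (\<lambda>x. 1 / (1 + exp (w + of_real x)) ^ m)" for m
    by (rule integrable_const_bound[where B = 1]) (use le1 in \<open>auto\<close>)
  have sums_I: "(\<lambda>n. I n * s ^ n) sums (\<integral>x. 1 / (1 - s + exp (w + of_real x)) \<partial>M)" if s: "norm s < 1" for s
  proof -
    have geo: "(\<lambda>n. 1 / (1 + exp (w + of_real x)) ^ Suc n * s ^ n) sums (1 / (1 - s + exp (w + of_real x)))" for x
    proof -
      let ?d = "1 + exp (w + of_real x)"
      have "norm (s / ?d) < 1" using s ge1[of x] by (simp add: norm_divide divide_less_eq)
      from sums_mult[OF geometric_sums[OF this], of "1 / ?d"] show ?thesis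
        using nz[of x] by (simp add: power_divide field_simps)
    qed
    have "(\<lambda>n. \<integral>x. 1 / (1 + exp (w + of_real x)) ^ Suc n * s ^ n \<partial>M) sums
      (\<integral>x. (\<Sum>n. 1 / (1 + exp (w + of_real x)) ^ Suc n * s ^ n) \<partial>M)"
    proof (rule sums_integral)
      show "integrable M (\<lambda>x. 1 / (1 + exp (w + of_real x)) ^ Suc n * s ^ n)" for n
        by (intro integrable_mult_left int)
      have "norm (1 / (1 + exp (w + of_real x)) ^ Suc n * s ^ n) \<le> norm s ^ n" for x n
        unfolding norm_mult norm_power using mult_right_mono[OF le1[of x "Suc n"], of "norm s ^ n"] by simp
      note b = this
      show "AE x in M. summable (\<lambda>n. norm (1 / (1 + exp (w + of_real x)) ^ Suc n * s ^ n))"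
        using b s by (intro AE_I2 summable_comparison_test'[OF summable_geometric[of "norm s"]]) auto
      show "summable (\<lambda>n. \<integral>x. norm (1 / (1 + exp (w + of_real x)) ^ Suc n * s ^ n) \<partial>M)"
      proof (rule summable_comparison_test')
        show "summable (\<lambda>n. norm s ^ n * measure M (space M))"
          using s by (intro summable_mult2 summable_geometric) auto
        have "(\<integral>x. norm (1 / (1 + exp (w + of_real x)) ^ Suc n * s ^ n) \<partial>M) \<le> (\<integral>x. norm s ^ n \<partial>M)" for n
          by (intro integral_mono integrable_norm integrable_mult_left int b) auto
        then show "norm (\<integral>x. norm (1 / (1 + exp (w + of_real x)) ^ Suc n * s ^ n) \<partial>M) \<le> norm s ^ n * measure M (space M)" for n
          by (simp add: integral_nonneg mult.commute)
      qed
    qed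
    then show ?thesis unfolding sums_unique[OF geo, symmetric] I_def integral_mult_left_zero .
  qed
  \<comment> \<open>The conditions for all three expansions hold for \<open>s\<close> near 0, which
    suffices for comparing coefficients.\<close>
  have "\<forall>\<^sub>F s in nhds 0. exp (Re w) < 1 - norm s \<and> norm s < norm (1 - exp w) \<and>
      Re (w - Ln (1 - s)) < 0 \<and> Im (w - Ln (1 - s)) < pi / 2 \<and> - (pi / 2) < Im (w - Ln (1 - s))"
  proof (intro eventually_conj)
    have c: "((\<lambda>s. w - Ln (1 - s)) \<longlongrightarrow> w - Ln (1 - 0)) (nhds 0)"
      by (intro tendsto_intros filterlim_ident) auto
    then have c: "((\<lambda>s. w - Ln (1 - s)) \<longlongrightarrow> w) (nhds 0)" by simp
    show "\<forall>\<^sub>F s in nhds 0. Re (w - Ln (1 - s)) < 0"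
      using w by (intro order_tendstoD(2)[OF tendsto_Re[OF c]]) auto
    show "\<forall>\<^sub>F s in nhds 0. Im (w - Ln (1 - s)) < pi / 2"
      using w by (intro order_tendstoD(2)[OF tendsto_Im[OF c]]) auto
    show "\<forall>\<^sub>F s in nhds 0. - (pi / 2) < Im (w - Ln (1 - s))"
      using w by (intro order_tendstoD(1)[OF tendsto_Im[OF c]]) auto
    have "((\<lambda>s::complex. norm s) \<longlongrightarrow> norm (0::complex)) (nhds 0)"
      by (intro tendsto_intros filterlim_ident)
    then have n: "((\<lambda>s::complex. norm s) \<longlongrightarrow> 0) (nhds 0)" by simp
    have "\<forall>\<^sub>F s in nhds (0::complex). norm s < 1 - exp (Re w)"
      using w by (intro order_tendstoD(2)[OF n]) auto
    then show "\<forall>\<^sub>F s in nhds (0::complex). exp (Re w) < 1 - norm s"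
      by eventually_elim simp
    show "\<forall>\<^sub>F s in nhds (0::complex). norm s < norm (1 - exp w)"
    proof (rule order_tendstoD(2)[OF n])
      have "exp w \<noteq> 1" using ew by (metis norm_one less_irrefl)
      then show "0 < norm (1 - exp w)" by simp
    qed
  qed
  then obtain r where r: "0 < r" "\<And>s. norm s < r \<Longrightarrow> exp (Re w) < 1 - norm s \<and> norm s < norm (1 - exp w) \<and>
      Re (w - Ln (1 - s)) < 0 \<and> Im (w - Ln (1 - s)) < pi / 2 \<and> - (pi / 2) < Im (w - Ln (1 - s))"
    unfolding eventually_nhds_metric by (auto simp: dist_norm)
  show ?thesis
  proof (rule powser_coeff_eq[OF r(1), where n = n and
        a = "\<lambda>n. ml_series \<alpha> 1 n (exp (of_real \<alpha> * w))" and
        b = "\<lambda>n. of_real c / (1 - exp w) ^ Suc n + (\<integral>x. 1 / (1 + exp (w + of_real x)) ^ Suc n \<partial>M)" and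
        f = "\<lambda>s. 1 / ((1 - s) * (1 - exp (of_real \<alpha> * (w - Ln (1 - s)))))"])
    fix s :: complex assume "norm s < r"
    note s = r(2)[OF this]
    have s1: "norm s < 1" using s by (smt (verit) exp_gt_zero)
    have s1': "1 - s \<noteq> 0" using s1 by auto
    have e: "exp (w - Ln (1 - s) + t) = exp (w + t) / (1 - s)" for t
      using s1' by (simp add: exp_diff exp_add)
    show "(\<lambda>n. ml_series \<alpha> 1 n (exp (of_real \<alpha> * w)) * s ^ n) sums
      (1 / ((1 - s) * (1 - exp (of_real \<alpha> * (w - Ln (1 - s))))))"
      by (rule ml_series_generating_function) (use s \<alpha> in auto)
    have "1 / ((1 - s) * (1 - exp (of_real \<alpha> * (w - Ln (1 - s))))) =
      (1 / (1 - s)) * (1 / (1 - exp (of_real \<alpha> * (w - Ln (1 - s)))))" by simp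
    also have "1 / (1 - exp (of_real \<alpha> * (w - Ln (1 - s)))) =
      of_real c / (1 - exp (w - Ln (1 - s))) + (\<integral>x. 1 / (1 + exp (w - Ln (1 - s) + of_real x)) \<partial>M)"
    proof (rule rep[rule_format])
      show "\<bar>Im (w - Ln (1 - s))\<bar> < pi / 2" using s by linarith
    qed (use s in blast)
    also have "(1 / (1 - s)) * \<dots> = (1 / (1 - s)) * (of_real c / (1 - exp (w - Ln (1 - s)))) +
        (\<integral>x. (1 / (1 - s)) * (1 / (1 + exp (w - Ln (1 - s) + of_real x))) \<partial>M)"
      by (simp only: distrib_left integral_mult_right_zero)
    also have "(\<lambda>x. (1 / (1 - s)) * (1 / (1 + exp (w - Ln (1 - s) + of_real x)))) = (\<lambda>x. 1 / (1 - s + exp (w + of_real x)))"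
      unfolding e using s1' by (intro ext) (simp add: distrib_left)
    also have "(1 / (1 - s)) * (of_real c / (1 - exp (w - Ln (1 - s)))) = of_real c / (1 - s - exp w)"
      using e[of 0] s1' by (simp add: right_diff_distrib)
    finally have val: "1 / ((1 - s) * (1 - exp (of_real \<alpha> * (w - Ln (1 - s))))) =
      of_real c / (1 - s - exp w) + (\<integral>x. 1 / (1 - s + exp (w + of_real x)) \<partial>M)" .
    have d: "1 - exp w \<noteq> 0" using ew by (metis norm_one less_irrefl right_minus_eq)
    have "norm (s / (1 - exp w)) < 1" using s d by (simp add: norm_divide)
    from sums_mult[OF geometric_sums[OF this], of "of_real c / (1 - exp w)"]
    have "(\<lambda>n. of_real c / (1 - exp w) ^ Suc n * s ^ n) sums (of_real c / (1 - exp w) * (1 / (1 - s / (1 - exp w))))"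
      by (simp add: power_divide)
    also have "of_real c / (1 - exp w) * (1 / (1 - s / (1 - exp w))) = of_real c / ((1 - exp w) * (1 - s / (1 - exp w)))" by simp
    also have "(1 - exp w) * (1 - s / (1 - exp w)) = 1 - s - exp w" using d by (simp add: right_diff_distrib)
    finally have "(\<lambda>n. of_real c / (1 - exp w) ^ Suc n * s ^ n) sums (of_real c / (1 - s - exp w))" .
    from sums_add[OF this sums_I[OF s1]]
    show "(\<lambda>n. (of_real c / (1 - exp w) ^ Suc n + (\<integral>x. 1 / (1 + exp (w + of_real x)) ^ Suc n \<partial>M)) * s ^ n) sums
       (1 / ((1 - s) * (1 - exp (of_real \<alpha> * (w - Ln (1 - s))))))"
      unfolding val by (simp only: distrib_right I_def)
  qed
qed


text \<open>With \<open>m = Re (exp w)\<close>, the denominators satisfy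
  \<open>|1 - exp w| \<ge> 1 - m\<close> and \<open>|1 + exp (w + x)| \<ge> 1 + m * exp x\<close>.
  Positivity of \<open>c\<close> and \<open>M\<close> turns this into a comparison with the same
  representation at \<open>ln m\<close>.\<close>

lemma norm_ml_series_1_le:
  fixes M :: "real measure" and w :: complex
  assumes rm: "resolvent_mixture \<alpha> c M"
    and w: "Re w < 0" "\<bar>Im w\<bar> < pi / 2"
  shows "norm (ml_series \<alpha> 1 n (exp (of_real \<alpha> * w))) \<le> ml_series \<alpha> 1 n (Re (exp w) powr \<alpha>)"
proof -
  have \<alpha>: "0 < \<alpha>" and c: "0 \<le> c" and M: "sets M = sets borel" and fm: "finite_measure M"
    using rm by (auto simp: resolvent_mixture_def)
  interpret finite_measure M by (rule fm)
  note M[measurable_cong]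
  define m where "m = Re (exp w)"
  have m: "0 < m" unfolding m_def using w by (intro Re_exp_pos)
  have "exp (Re w) < 1" using w by simp
  then have m1: "m < 1" using complex_Re_le_cmod[of "exp w"] unfolding m_def norm_exp_eq_Re by linarith
  have em: "exp (complex_of_real (ln m)) = of_real m" using m by (simp add: exp_of_real)
  have lm: "Re (of_real (ln m)) < 0" "\<bar>Im (of_real (ln m))\<bar> < pi / 2" using m m1 by auto
  note * = ml_series_eq_integral[OF rm]
  have pos: "0 < 1 + m * exp x" for x using m by (simp add: add_pos_pos)
  have real: "ml_series \<alpha> 1 n (m powr \<alpha>) = c / (1 - m) ^ Suc n + (\<integral>x. 1 / (1 + m * exp x) ^ Suc n \<partial>M)"
  proof -
    have "exp (of_real \<alpha> * complex_of_real (ln m)) = of_real (m powr \<alpha>)"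
      using m by (simp add: powr_def exp_of_real flip: of_real_mult)
    then have "complex_of_real (ml_series \<alpha> 1 n (m powr \<alpha>)) = ml_series \<alpha> 1 n (exp (of_real \<alpha> * complex_of_real (ln m)))"
      using \<alpha> m m1 powr_less_mono2[of \<alpha> m 1] by (subst ml_series_of_real[symmetric]) auto
    also have "\<dots> = of_real c / (1 - of_real m) ^ Suc n +
      (\<integral>x. 1 / (1 + of_real m * exp (of_real x)) ^ Suc n \<partial>M)"
      using *[OF lm, of n] unfolding exp_add em .
    also have "(\<lambda>x. 1 / (1 + of_real m * exp (of_real x)) ^ Suc n) = (\<lambda>x. complex_of_real (1 / (1 + m * exp x) ^ Suc n))"
      by (simp add: exp_of_real)
    finally have "complex_of_real (ml_series \<alpha> 1 n (m powr \<alpha>)) =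
      of_real (c / (1 - m) ^ Suc n + (\<integral>x. 1 / (1 + m * exp x) ^ Suc n \<partial>M))"
      by (simp only: integral_complex_of_real) simp
    then show ?thesis by (simp only: of_real_eq_iff)
  qed
  have "norm (ml_series \<alpha> 1 n (exp (of_real \<alpha> * w))) \<le> norm (of_real c / (1 - exp w) ^ Suc n) +
      norm (\<integral>x. 1 / (1 + exp (w + of_real x)) ^ Suc n \<partial>M)"
    unfolding *[OF w] by (rule norm_triangle_ineq)
  also have "\<dots> \<le> c / (1 - m) ^ Suc n + (\<integral>x. 1 / (1 + m * exp x) ^ Suc n \<partial>M)"
  proof (intro add_mono)
    have "1 - m \<le> norm (1 - exp w)" using complex_Re_le_cmod[of "1 - exp w"] by (simp add: m_def)
    then have "(1 - m) ^ Suc n \<le> norm (1 - exp w) ^ Suc n" using m1 by (intro power_mono) auto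
    then show "norm (of_real c / (1 - exp w) ^ Suc n) \<le> c / (1 - m) ^ Suc n"
      unfolding norm_divide norm_power using c m1 by (simp only: norm_of_real abs_of_nonneg)
        (intro frac_le zero_less_power, auto)
    have le: "norm (1 / (1 + exp (w + of_real x)) ^ Suc n) \<le> 1 / (1 + m * exp x) ^ Suc n" for x
    proof -
      have "1 + m * exp x \<le> norm (1 + exp (w + of_real x))"
        using complex_Re_le_cmod[of "1 + exp (w + of_real x)"] by (simp add: m_def exp_add exp_of_real)
      then have "(1 + m * exp x) ^ Suc n \<le> norm (1 + exp (w + of_real x)) ^ Suc n"
        using pos[of x] by (intro power_mono) auto
      then show ?thesis using zero_less_power[OF pos[of x], of "Suc n"]
        unfolding norm_divide norm_power by (simp only: norm_one) (intro frac_le, auto)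
    qed
    have i: "integrable M (\<lambda>x. 1 / (1 + m * exp x) ^ Suc n)"
    proof (rule integrable_const_bound[where B = 1])
      have "1 \<le> (1 + m * exp x) ^ Suc n" for x using m by (intro one_le_power) auto
      then show "AE x in M. norm (1 / (1 + m * exp x) ^ Suc n) \<le> 1"
        using pos by (intro AE_I2) (auto simp: divide_le_eq abs_of_pos simp del: power_Suc)
    qed measurable
    have "integrable M (\<lambda>x. 1 / (1 + exp (w + of_real x)) ^ Suc n)"
    proof (rule Bochner_Integration.integrable_bound[OF i])
      show "AE x in M. norm (1 / (1 + exp (w + of_real x)) ^ Suc n) \<le> norm (1 / (1 + m * exp x) ^ Suc n)"
        using le by (intro AE_I2) (smt (verit) real_norm_def)
    qed measurable
    then show "norm (\<integral>x. 1 / (1 + exp (w + of_real x)) ^ Suc n \<partial>M) \<le> (\<integral>x. 1 / (1 + m * exp x) ^ Suc n \<partial>M)"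
      by (rule Bochner_Integration.integral_norm_bound_integral[OF _ i]) (rule le)
  qed
  also have "\<dots> = ml_series \<alpha> 1 n (m powr \<alpha>)" by (rule real[symmetric])
  finally show ?thesis unfolding m_def .
qed

lemma norm_mittag_leffler_le:
  fixes M :: "real measure"
  assumes rm: "resolvent_mixture \<alpha> c M"
    and \<beta>: "1 \<le> \<beta>" and w: "\<bar>Im w\<bar> < pi / 2"
  shows "norm (mittag_leffler \<alpha> \<beta> (exp (of_real \<alpha> * w))) \<le> mittag_leffler \<alpha> \<beta> (Re (exp w) powr \<alpha>)"
proof (rule LIMSEQ_le)
  have \<alpha>: "0 < \<alpha>" using rm by (simp add: resolvent_mixture_def)
  show "(\<lambda>n. norm (of_real (real n powr (1 - \<beta>)) * ml_series \<alpha> \<beta> n (exp (of_real \<alpha> * w) / of_real (real n powr \<alpha>))))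
    \<longlonglongrightarrow> norm (mittag_leffler \<alpha> \<beta> (exp (of_real \<alpha> * w)))"
    by (intro tendsto_norm ml_series_limit \<alpha> \<beta>)
  show "(\<lambda>n. real n powr (1 - \<beta>) * ml_series \<alpha> \<beta> n (Re (exp w) powr \<alpha> / real n powr \<alpha>))
    \<longlonglongrightarrow> mittag_leffler \<alpha> \<beta> (Re (exp w) powr \<alpha>)"
    using ml_series_limit[OF \<alpha> \<beta>, of "Re (exp w) powr \<alpha>"] by simp
  obtain N where N: "exp (Re w) < real N" using reals_Archimedean2 by blast
  show "\<exists>N. \<forall>n\<ge>N. norm (of_real (real n powr (1 - \<beta>)) * ml_series \<alpha> \<beta> n (exp (of_real \<alpha> * w) / of_real (real n powr \<alpha>)))
    \<le> real n powr (1 - \<beta>) * ml_series \<alpha> \<beta> n (Re (exp w) powr \<alpha> / real n powr \<alpha>)"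
  proof (intro exI allI impI)
    fix n assume "N \<le> n"
    then have n: "exp (Re w) < real n" "0 < n" using N less_trans[OF exp_gt_zero N] by (auto simp: of_nat_less_iff)
    \<comment> \<open>Subtracting \<open>ln n\<close> divides \<open>exp w\<close> by
      \<open>n\<close> and \<open>exp (\<alpha> * w)\<close> by \<open>n powr \<alpha>\<close>; once
      \<open>n > exp (Re w)\<close>, the point lies in the half-strip of the representation.\<close>
    define v where "v = w - of_real (ln (real n))"
    have "ln (exp (Re w)) < ln (real n)" using n by (subst ln_less_cancel_iff) auto
    then have v: "Re v < 0" "\<bar>Im v\<bar> < pi / 2" using w by (auto simp: v_def)
    have Re_v: "Re (exp v) = Re (exp w) / real n"
      using n by (simp add: v_def exp_diff exp_of_real)
    have p: "0 < Re (exp w)" "0 < Re (exp v)" using w v by (auto intro: Re_exp_pos)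
    have ev: "exp (of_real \<alpha> * v) = exp (of_real \<alpha> * w) / of_real (real n powr \<alpha>)"
      using n by (simp add: v_def right_diff_distrib exp_diff powr_def flip: exp_of_real)
    have er: "Re (exp v) powr \<alpha> = Re (exp w) powr \<alpha> / real n powr \<alpha>"
      unfolding Re_v using p by (simp add: powr_divide)
    have l1: "norm (exp (of_real \<alpha> * v)) < 1" using v \<alpha> by (simp add: mult_pos_neg)
    have "exp (Re v) < 1" using v by simp
    then have "Re (exp v) < 1" using complex_Re_le_cmod[of "exp v"] unfolding norm_exp_eq_Re by linarith
    then have l2: "norm (Re (exp v) powr \<alpha>) < 1"
      using p \<alpha> powr_less_mono2[of \<alpha> "Re (exp v)" 1] by auto
    have "norm (ml_series \<alpha> ((\<beta> - 1) + 1) n (exp (of_real \<alpha> * v))) \<le>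
      (\<Sum>j\<le>n. rising (\<beta> - 1) j * ml_series \<alpha> 1 (n - j) (Re (exp v) powr \<alpha>))"
      unfolding ml_series_add[OF \<alpha> zero_le_one l1]
    proof (rule sum_norm_le)
      fix j
      show "norm (of_real (rising (\<beta> - 1) j) * ml_series \<alpha> 1 (n - j) (exp (of_real \<alpha> * v)))
        \<le> rising (\<beta> - 1) j * ml_series \<alpha> 1 (n - j) (Re (exp v) powr \<alpha>)"
        using norm_ml_series_1_le[OF rm v, of "n - j"] \<beta>
        by (simp add: norm_mult rising_nonneg mult_left_mono)
    qed
    also have "\<dots> = ml_series \<alpha> ((\<beta> - 1) + 1) n (Re (exp v) powr \<alpha>)"
      using ml_series_add[OF \<alpha> zero_le_one l2, of "\<beta> - 1" n] by simp
    finally show "norm (of_real (real n powr (1 - \<beta>)) * ml_series \<alpha> \<beta> n (exp (of_real \<alpha> * w) / of_real (real n powr \<alpha>)))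
      \<le> real n powr (1 - \<beta>) * ml_series \<alpha> \<beta> n (Re (exp w) powr \<alpha> / real n powr \<alpha>)"
      by (simp add: norm_mult mult_left_mono ev er)
  qed
qed

text \<open>Partial fractions of \<open>1 / (1 - y ^ 2)\<close> with \<open>y = exp w\<close>: the
  mixing measure is half a point mass at \<open>x = 0\<close>.\<close>

lemma resolvent_mixture_2:
  "resolvent_mixture 2 (1 / 2) (density (return borel 0) (\<lambda>_. ennreal (1 / 2)))"
  unfolding resolvent_mixture_def
proof (intro conjI allI impI)
  show "finite_measure (density (return borel (0::real)) (\<lambda>_. ennreal (1 / 2)))"
    by (rule finite_measureI) (simp add: emeasure_density emeasure_return nn_integral_return)
  fix w :: complex assume w: "Re w < 0" "\<bar>Im w\<bar> < pi / 2"
  have n: "norm (exp w) \<noteq> 1" using w by simp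
  have "exp w \<noteq> 1" "exp w \<noteq> - 1" using n by (metis norm_one, metis norm_minus_cancel norm_one)
  then have nz: "exp w \<noteq> 1" "1 + exp w \<noteq> 0" by (simp_all add: add_eq_0_iff)
  have "exp (of_real 2 * w) = exp w * exp w" by (simp add: exp_double power2_eq_square)
  then have e: "1 - exp (of_real 2 * w) = (1 - exp w) * (1 + exp w)" by (simp add: algebra_simps)
  have key: "1 / ((1 - exp w) * (1 + exp w)) = 1 / 2 / (1 - exp w) + 1 / 2 * (1 / (1 + exp w))"
  proof -
    have "1 / 2 / (1 - exp w) + 1 / 2 * (1 / (1 + exp w)) = (1 / 2 * (1 + exp w) + 1 / 2 * (1 - exp w)) / ((1 - exp w) * (1 + exp w))"
      using nz by (subst times_divide_eq_right, subst add_frac_eq) simp_all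
    also have "1 / 2 * (1 + exp w) + 1 / 2 * (1 - exp w) = 1" by (simp flip: add_divide_distrib)
    finally show ?thesis by simp
  qed
  have "(\<integral>x. 1 / (1 + exp (w + complex_of_real x)) \<partial>density (return borel 0) (\<lambda>_. ennreal (1 / 2))) =
    (1 / 2) *\<^sub>R (1 / (1 + exp w))"
    by (subst integral_density) (simp_all add: integral_return)
  then show "1 / (1 - exp (of_real 2 * w)) = of_real (1 / 2) / (1 - exp w) +
      (\<integral>x. 1 / (1 + exp (w + complex_of_real x)) \<partial>density (return borel 0) (\<lambda>_. ennreal (1 / 2)))"
    unfolding e key by (simp add: scaleR_conv_of_real)
qed auto

lemma resolvent_mixture_kernel:
  assumes "1 < \<alpha>" "\<alpha> < 2"
  shows "resolvent_mixture \<alpha> (1 / \<alpha>) (density lborel (kernel \<alpha>))"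
  unfolding resolvent_mixture_def
proof (intro conjI allI impI)
  have [measurable]: "kernel \<alpha> \<in> borel_measurable lborel" unfolding kernel_def by measurable
  have "emeasure (density lborel (kernel \<alpha>)) UNIV = (\<integral>\<^sup>+x. ennreal (kernel \<alpha> x) \<partial>lborel)"
    by (simp add: emeasure_density)
  also have "\<dots> = ennreal (\<integral>x. kernel \<alpha> x \<partial>lborel)"
    using integrable_kernel[OF assms] kernel_bounds(1)[OF assms] by (intro nn_integral_eq_integral) auto
  finally show "finite_measure (density lborel (kernel \<alpha>))"
    by (intro finite_measureI) simp
  fix w :: complex assume w: "Re w < 0" "\<bar>Im w\<bar> < pi / 2"
  have "(\<integral>x. 1 / (1 + exp (w + complex_of_real x)) \<partial>density lborel (kernel \<alpha>)) =
    (\<integral>x. kernel \<alpha> x *\<^sub>R (1 / (1 + exp (w + of_real x))) \<partial>lborel)"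
    by (rule integral_density) (use kernel_bounds(1)[OF assms] in auto)
  then show "1 / (1 - exp (of_real \<alpha> * w)) = of_real (1 / \<alpha>) / (1 - exp w) +
      (\<integral>x. 1 / (1 + exp (w + complex_of_real x)) \<partial>density lborel (kernel \<alpha>))"
    using kernel_identity[OF assms w] by simp
qed (use assms in auto)

section \<open>The exponential case and the principal branch\<close>

lemma mittag_leffler_1_1:
  fixes z :: "'a::{real_normed_field,banach}"
  shows "mittag_leffler 1 1 z = exp z"
proof -
  have "rGamma (1 * real k + 1) = inverse (fact k)" for k
    by (simp add: rGamma_inverse_Gamma Gamma_fact[symmetric] add.commute)
  then show ?thesis
    unfolding mittag_leffler_def exp_def by (simp only: scaleR_conv_of_real)
qed

text \<open>The substitution \<open>w = Ln z / \<alpha>\<close> turns the sector condition into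
  \<open>|Im w| < pi / 2\<close> and \<open>exp w\<close> into the principal power. The point
  \<open>z = 0\<close> has no logarithm; there both sides are the positive number
  \<open>rGamma \<beta>\<close>.\<close>

lemma norm_mittag_leffler_le_of_mixture:
  assumes rm: "resolvent_mixture \<alpha> c M" and \<beta>: "1 \<le> \<beta>"
    and z: "z \<noteq> 0 \<Longrightarrow> \<bar>Im (Ln z)\<bar> < \<alpha> * (pi / 2)"
  shows "norm (mittag_leffler \<alpha> \<beta> z) \<le> mittag_leffler \<alpha> \<beta> (Re (z powr of_real (1 / \<alpha>)) powr \<alpha>)"
proof (cases "z = 0")
  case True
  have "0 < rGamma \<beta>" using \<beta> by (simp add: rGamma_inverse_Gamma Gamma_real_pos)
  then show ?thesis using True by (simp add: mittag_leffler_def)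
next
  case False
  have \<alpha>: "0 < \<alpha>" using rm by (simp add: resolvent_mixture_def)
  define w where "w = Ln z / of_real \<alpha>"
  have "\<bar>Im w\<bar> < pi / 2"
    using z[OF False] \<alpha> by (simp add: w_def abs_divide divide_less_eq mult.commute)
  moreover have "exp (of_real \<alpha> * w) = z" using \<alpha> False by (simp add: w_def)
  moreover have "exp w = z powr of_real (1 / \<alpha>)" using False by (simp add: w_def powr_def)
  ultimately show ?thesis using norm_mittag_leffler_le[OF rm \<beta>, of w] by simp
qed

theorem proposition9:
  fixes \<alpha> \<beta> :: real
  shows "(1 \<le> \<alpha> \<and> \<alpha> < 2 \<and> 1 \<le> \<beta> \<and> \<beta> \<le> \<alpha> \<longrightarrow>
           (\<forall>z::complex. Re z \<ge> 0 \<longrightarrow>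
              mittag_leffler \<alpha> \<beta> (Re z) \<le> cmod (mittag_leffler \<alpha> \<beta> z) \<and>
              cmod (mittag_leffler \<alpha> \<beta> z)
                \<le> mittag_leffler \<alpha> \<beta> (Re (z powr complex_of_real (1 / \<alpha>)) powr \<alpha>)))
       \<and> (\<alpha> = 2 \<and> 1 \<le> \<beta> \<and> \<beta> \<le> 3 \<longrightarrow>
           (\<forall>z::complex. z \<notin> \<real>\<^sub>\<le>\<^sub>0 \<longrightarrow>
              mittag_leffler \<alpha> \<beta> (Re z) \<le> cmod (mittag_leffler \<alpha> \<beta> z) \<and>
              cmod (mittag_leffler \<alpha> \<beta> z)
                \<le> mittag_leffler \<alpha> \<beta> (Re (z powr complex_of_real (1 / \<alpha>)) powr \<alpha>)))"
proof (intro conjI impI allI; elim conjE)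
  fix z :: complex
  assume a: "1 \<le> \<alpha>" "\<alpha> < 2" "1 \<le> \<beta>" "\<beta> \<le> \<alpha>" and z: "0 \<le> Re z"
  show "mittag_leffler \<alpha> \<beta> (Re z) \<le> cmod (mittag_leffler \<alpha> \<beta> z)"
    by (rule mittag_leffler_ge_of_ml_poly_ge; (rule ml_poly_norm_ge)?) (use a z in auto)
  show "cmod (mittag_leffler \<alpha> \<beta> z) \<le> mittag_leffler \<alpha> \<beta> (Re (z powr complex_of_real (1 / \<alpha>)) powr \<alpha>)"
  proof (cases "\<alpha> = 1")
    case True
    \<comment> \<open>The kernel representation covers only \<open>\<alpha> > 1\<close>. Here the
      function is \<open>exp\<close>, and the upper bound is the equality
      \<open>|exp z| = exp (Re z)\<close>.\<close>
    then have "\<beta> = 1" using a by simp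
    then show ?thesis using True z by (cases "z = 0") (simp_all add: mittag_leffler_1_1)
  next
    case False
    then have \<alpha>: "1 < \<alpha>" using a by simp
    show ?thesis
    proof (rule norm_mittag_leffler_le_of_mixture[OF resolvent_mixture_kernel[OF \<alpha> a(2)] a(3)])
      assume "z \<noteq> 0"
      \<comment> \<open>The closed right half-plane lies in the open sector because
        \<open>\<alpha> > 1\<close>.\<close>
      then have "\<bar>Im (Ln z)\<bar> \<le> 1 * (pi / 2)" using z Re_Ln_pos_le by simp
      also have "\<dots> < \<alpha> * (pi / 2)" using \<alpha> by (intro mult_strict_right_mono) auto
      finally show "\<bar>Im (Ln z)\<bar> < \<alpha> * (pi / 2)" .
    qed
  qed
next
  fix z :: complex
  assume a: "\<alpha> = 2" "1 \<le> \<beta>" "\<beta> \<le> 3" and z: "z \<notin> \<real>\<^sub>\<le>\<^sub>0"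
  show "mittag_leffler \<alpha> \<beta> (Re z) \<le> cmod (mittag_leffler \<alpha> \<beta> z)"
    unfolding a(1)
    by (rule mittag_leffler_ge_of_ml_poly_ge; (rule ml_poly_2_norm_ge)?) (use a in auto)
  \<comment> \<open>For \<open>\<alpha> = 2\<close> the sector
    \<open>|arg z| < \<alpha> * (pi / 2)\<close> is exactly the slit plane.\<close>
  have "\<bar>Im (Ln z)\<bar> < pi"
    using z mpi_less_Im_Ln[of z] Im_Ln_less_pi[of z] by (cases "z = 0") (auto simp: abs_less_iff)
  then show "cmod (mittag_leffler \<alpha> \<beta> z) \<le> mittag_leffler \<alpha> \<beta> (Re (z powr complex_of_real (1 / \<alpha>)) powr \<alpha>)"
    unfolding a(1) by (intro norm_mittag_leffler_le_of_mixture[OF resolvent_mixture_2 a(2)]) simp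
qed

end
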